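(* Let $X$ and $Y$ be compact metric spaces, $m$ and $n$ regular Borel measures on $X$ and $Y$ respectively, $\mathcal{H}_1=L^2(X,m)$, $\mathcal{H}_2=L^2(Y,n)$. Let $\kappa_1,\kappa_2\subseteq X\times Y$ be closed synthetic sets. Then the set $\kappa=\kappa_1\cup\kappa_2$ is synthetic if and only if $\mathcal{M}_{max}(\kappa_1)+\mathcal{M}_{max}(\kappa_2)$ is dense in $\mathcal{M}_{max}(\kappa)$ in the ultraweak topology.
   Context: Let $\mathcal{D}_1,\mathcal{D}_2$ be the multiplication masas of $L^\infty(X,m)$ on $\mathcal{H}_1$ and $L^\infty(Y,n)$ on $\mathcal{H}_2$. $P(\alpha)$ denotes the projection of multiplication by the characteristic function of a Borel set $\alpha$. A subset of $X\times Y$ is marginally null if it is contained in $(M\times Y)\cup(X\times N)$ with $M\subseteq X$, $N\subseteq Y$ null sets. For a closed set $\kappa\subseteq X\times Y$, $\mathcal{M}_{max}(\kappa)$ is the set of operators $T\in\mathcal{B}(\mathcal{H}_1,\mathcal{H}_2)$ supported on $\kappa$, i.e. with $P(\beta)TP(\alpha)=0$ for each Borel rectangle $\alpha\times\beta$ whose intersection with $\kappa$ is marginally null. For a subspace $\mathcal{U}\subseteq\mathcal{B}(\mathcal{H}_1,\mathcal{H}_2)$, $\mathrm{Map}\,\mathcal{U}$ is the map sending a projection $P$ on $\mathcal{H}_1$ to the projection onto the closed linear span of $\{Sx:S\in\mathcal{U},x\in P\mathcal{H}_1\}$. The set $\kappa$ is synthetic if $\mathcal{M}_{max}(\kappa)$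 is the only weak*-closed (i.e. ultraweakly closed) subspace $\mathcal{U}\subseteq\mathcal{B}(\mathcal{H}_1,\mathcal{H}_2)$ with $\mathcal{D}_2\mathcal{U}\mathcal{D}_1\subseteq\mathcal{U}$ and $\mathrm{Map}\,\mathcal{U}=\mathrm{Map}\,\mathcal{M}_{max}(\kappa)$. *)

theory Defs
  imports "HOL-Analysis.Analysis"
begin

section \<open>Compact metric spaces and regular Borel measures\<close>

class compact_metric_space = metric_space +
  assumes compact_UNIV: "compact (UNIV :: 'a set)"

text \<open>The following two instances make the library results on Polish spaces available.\<close>

instance compact_metric_space \<subseteq> complete_space
proof
  fix X :: "nat \<Rightarrow> 'a"
  assume "Cauchy X"
  moreover have "complete (UNIV :: 'a set)"
    using compact_imp_complete compact_UNIV by blast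
  ultimately show "convergent X"
    unfolding complete_def convergent_def by blast
qed

instance compact_metric_space \<subseteq> second_countable_topology
proof
  have "\<exists>K. finite K \<and> (UNIV :: 'a set) \<subseteq> (\<Union>x\<in>K. ball x (1 / real (Suc n)))" for n
  proof -
    have "\<forall>e>0. \<exists>K. finite K \<and> (UNIV :: 'a set) \<subseteq> (\<Union>x\<in>K. ball x e)"
      using compact_UNIV unfolding compact_eq_totally_bounded by blast
    moreover have "1 / real (Suc n) > 0"
      by simp
    ultimately show ?thesis
      by blast
  qed
  then obtain K :: "nat \<Rightarrow> 'a set"
    where fin: "\<And>n. finite (K n)"
      and cov: "\<And>n. UNIV \<subseteq> (\<Union>x\<in>K n. ball x (1 / real (Suc n)))"
    by metis
  define B where "B = (\<Union>n. (\<lambda>x. ball x (1 / real (Suc n))) ` K n)"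
  have "countable B"
    unfolding B_def using fin by (simp add: countable_finite)
  moreover have "open S \<longleftrightarrow> generate_topology B S" for S :: "'a set"
  proof
    assume "open S"
    have "\<exists>b\<in>B. x \<in> b \<and> b \<subseteq> S" if x: "x \<in> S" for x
    proof -
      obtain e where e: "e > 0" "ball x e \<subseteq> S"
        using \<open>open S\<close> x openE by blast
      obtain n where n: "1 / real (Suc n) < e / 2"
        using nat_approx_posE[of "e / 2"] e by auto
      obtain y where y: "y \<in> K n" "x \<in> ball y (1 / real (Suc n))"
        using cov[of n] by blast
      have "ball y (1 / real (Suc n)) \<subseteq> ball x e"
      proof
        fix z
        assume z: "z \<in> ball y (1 / real (Suc n))"
        have "dist x z \<le> dist y x + dist y z"
          by (metis dist_commute dist_triangle)
        also have "\<dots> < e"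
          using y z n unfolding mem_ball by linarith
        finally show "z \<in> ball x e"
          by simp
      qed
      with e y show ?thesis
        unfolding B_def by blast
    qed
    then have "S = \<Union>{b \<in> B. b \<subseteq> S}"
      by blast
    then show "generate_topology B S"
      by (metis (no_types, lifting) generate_topology.Basis generate_topology.UN mem_Collect_eq)
  next
    assume "generate_topology B S"
    then show "open S"
      by induction (auto simp: B_def)
  qed
  ultimately show "\<exists>B :: 'a set set. countable B \<and> open = generate_topology B"
    by blast
qed

instance compact_metric_space \<subseteq> polish_space ..

definition regular_borel_measure :: "'a::topological_space measure \<Rightarrow> bool" where
  "regular_borel_measure m \<longleftrightarrow>
     sets m = sets borel \<and>
     (\<forall>K. compact K \<longrightarrow> emeasure m K < \<infinity>) \<and>
     (\<forall>A\<in>sets borel. emeasure m A = (INF U\<in>{U. open U \<and> A \<subseteq> U}. emeasure m U)) \<and>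
     (\<forall>A\<in>sets borel. emeasure m A = (SUP K\<in>{K. compact K \<and> K \<subseteq> A}. emeasure m K))"


section \<open>The Hilbert space of square-integrable functions\<close>

text \<open>
  Vectors are equivalence classes of measurable functions modulo equality almost everywhere.
  The operations on classes go through arbitrarily chosen representatives; the lemmas at the
  end of the section show that they do not depend on that choice.
\<close>

definition square_integrable :: "'a measure \<Rightarrow> ('a \<Rightarrow> complex) \<Rightarrow> bool" where
  "square_integrable m f \<longleftrightarrow> f \<in> borel_measurable m \<and> integrable m (\<lambda>x. (cmod (f x))\<^sup>2)"

definition ae_class :: "'a measure \<Rightarrow> ('a \<Rightarrow> complex) \<Rightarrow> ('a \<Rightarrow> complex) set" where
  "ae_class m f = {g \<in> borel_measurable m. AE x in m. g x = f x}"

definition L2 :: "'a measure \<Rightarrow> ('a \<Rightarrow> complex) set set" where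
  "L2 m = ae_class m ` {f. square_integrable m f}"

definition l2_rep :: "('a \<Rightarrow> complex) set \<Rightarrow> 'a \<Rightarrow> complex" where
  "l2_rep u = (SOME f. f \<in> u)"

definition l2_zero :: "'a measure \<Rightarrow> ('a \<Rightarrow> complex) set" where
  "l2_zero m = ae_class m (\<lambda>x. 0)"

definition l2_add ::
  "'a measure \<Rightarrow> ('a \<Rightarrow> complex) set \<Rightarrow> ('a \<Rightarrow> complex) set \<Rightarrow> ('a \<Rightarrow> complex) set" where
  "l2_add m u v = ae_class m (\<lambda>x. l2_rep u x + l2_rep v x)"

definition l2_scale ::
  "'a measure \<Rightarrow> complex \<Rightarrow> ('a \<Rightarrow> complex) set \<Rightarrow> ('a \<Rightarrow> complex) set" where
  "l2_scale m c u = ae_class m (\<lambda>x. c * l2_rep u x)"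

definition l2_inner :: "'a measure \<Rightarrow> ('a \<Rightarrow> complex) set \<Rightarrow> ('a \<Rightarrow> complex) set \<Rightarrow> complex" where
  "l2_inner m u v = (LINT x|m. l2_rep u x * cnj (l2_rep v x))"

definition l2_norm :: "'a measure \<Rightarrow> ('a \<Rightarrow> complex) set \<Rightarrow> real" where
  "l2_norm m u = sqrt (LINT x|m. (cmod (l2_rep u x))\<^sup>2)"

text \<open>
  The distance is written with pointwise differences of representatives rather than through
  \<open>l2_add\<close> and \<open>l2_scale\<close>, so that it is symmetric also outside \<open>L2 m\<close>, as the library's locale
  \<^locale>\<open>Metric_space\<close> requires.
\<close>

definition l2_dist :: "'a measure \<Rightarrow> ('a \<Rightarrow> complex) set \<Rightarrow> ('a \<Rightarrow> complex) set \<Rightarrow> real" where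
  "l2_dist m u v = sqrt (LINT x|m. (cmod (l2_rep u x - l2_rep v x))\<^sup>2)"

definition l2_subspace :: "'a measure \<Rightarrow> ('a \<Rightarrow> complex) set set \<Rightarrow> bool" where
  "l2_subspace m V \<longleftrightarrow>
     V \<subseteq> L2 m \<and> l2_zero m \<in> V \<and>
     (\<forall>u\<in>V. \<forall>v\<in>V. l2_add m u v \<in> V) \<and> (\<forall>c. \<forall>u\<in>V. l2_scale m c u \<in> V)"

definition l2_closed_span :: "'a measure \<Rightarrow> ('a \<Rightarrow> complex) set set \<Rightarrow> ('a \<Rightarrow> complex) set set" where
  "l2_closed_span m S =
     \<Inter>{V. l2_subspace m V \<and> closedin (Metric_space.mtopology (L2 m) (l2_dist m)) V \<and> S \<subseteq> V}"

lemma ae_class_cong: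
  assumes "AE x in m. f x = g x"
  shows "ae_class m f = ae_class m g"
  unfolding ae_class_def using assms by (auto elim!: AE_mp)

lemma l2_rep_ae_class:
  assumes "f \<in> borel_measurable m"
  shows "l2_rep (ae_class m f) \<in> borel_measurable m" and "AE x in m. l2_rep (ae_class m f) x = f x"
proof -
  have "f \<in> ae_class m f"
    using assms by (simp add: ae_class_def)
  then have "l2_rep (ae_class m f) \<in> ae_class m f"
    unfolding l2_rep_def by (rule someI[where P = "\<lambda>h. h \<in> ae_class m f"])
  then show "l2_rep (ae_class m f) \<in> borel_measurable m" "AE x in m. l2_rep (ae_class m f) x = f x"
    by (auto simp: ae_class_def)
qed

lemma l2_add_ae_class:
  assumes "f \<in> borel_measurable m" "g \<in> borel_measurable m"
  shows "l2_add m (ae_class m f) (ae_class m g) = ae_class m (\<lambda>x. f x + g x)"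
  unfolding l2_add_def
  by (rule ae_class_cong) (use l2_rep_ae_class(2)[OF assms(1)] l2_rep_ae_class(2)[OF assms(2)] in auto)

lemma l2_scale_ae_class:
  assumes "f \<in> borel_measurable m"
  shows "l2_scale m c (ae_class m f) = ae_class m (\<lambda>x. c * f x)"
  unfolding l2_scale_def
  by (rule ae_class_cong) (use l2_rep_ae_class(2)[OF assms] in auto)

lemma l2_inner_ae_class:
  assumes "f \<in> borel_measurable m" "g \<in> borel_measurable m"
  shows "l2_inner m (ae_class m f) (ae_class m g) = (LINT x|m. f x * cnj (g x))"
  unfolding l2_inner_def
proof (rule integral_cong_AE)
  note [measurable] = assms l2_rep_ae_class(1)[OF assms(1)] l2_rep_ae_class(1)[OF assms(2)]
  show "(\<lambda>x. l2_rep (ae_class m f) x * cnj (l2_rep (ae_class m g) x)) \<in> borel_measurable m"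
    by (intro borel_measurable_times borel_measurable_continuous_on[where f = cnj])
      (auto intro: continuous_intros)
  show "(\<lambda>x. f x * cnj (g x)) \<in> borel_measurable m"
    by (intro borel_measurable_times borel_measurable_continuous_on[where f = cnj])
      (auto intro: continuous_intros)
  show "AE x in m. l2_rep (ae_class m f) x * cnj (l2_rep (ae_class m g) x) = f x * cnj (g x)"
    using l2_rep_ae_class(2)[OF assms(1)] l2_rep_ae_class(2)[OF assms(2)] by auto
qed

lemma l2_norm_ae_class:
  assumes "f \<in> borel_measurable m"
  shows "l2_norm m (ae_class m f) = sqrt (LINT x|m. (cmod (f x))\<^sup>2)"
proof -
  note [measurable] = assms l2_rep_ae_class(1)[OF assms]
  have "(LINT x|m. (cmod (l2_rep (ae_class m f) x))\<^sup>2) = (LINT x|m. (cmod (f x))\<^sup>2)"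
    by (rule integral_cong_AE) (use l2_rep_ae_class(2)[OF assms] in auto)
  then show ?thesis
    by (simp add: l2_norm_def)
qed

lemma l2_dist_ae_class:
  assumes "f \<in> borel_measurable m" "g \<in> borel_measurable m"
  shows "l2_dist m (ae_class m f) (ae_class m g) = sqrt (LINT x|m. (cmod (f x - g x))\<^sup>2)"
proof -
  note [measurable] = assms l2_rep_ae_class(1)[OF assms(1)] l2_rep_ae_class(1)[OF assms(2)]
  have "(LINT x|m. (cmod (l2_rep (ae_class m f) x - l2_rep (ae_class m g) x))\<^sup>2) =
      (LINT x|m. (cmod (f x - g x))\<^sup>2)"
    by (rule integral_cong_AE)
      (use l2_rep_ae_class(2)[OF assms(1)] l2_rep_ae_class(2)[OF assms(2)] in auto)
  then show ?thesis
    by (simp add: l2_dist_def)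
qed


section \<open>Bounded operators\<close>

text \<open>
  Operators are extensional functions on the space of classes, so that equality of operators is
  equality in the logic; composition is \<^const>\<open>compose\<close> on the domain space.
\<close>

type_synonym ('a, 'b) l2_op = "('a \<Rightarrow> complex) set \<Rightarrow> ('b \<Rightarrow> complex) set"

definition bounded_ops :: "'a measure \<Rightarrow> 'b measure \<Rightarrow> ('a, 'b) l2_op set" where
  "bounded_ops m n =
     {T \<in> L2 m \<rightarrow>\<^sub>E L2 n.
        (\<forall>u\<in>L2 m. \<forall>v\<in>L2 m. T (l2_add m u v) = l2_add n (T u) (T v)) \<and>
        (\<forall>c. \<forall>u\<in>L2 m. T (l2_scale m c u) = l2_scale n c (T u)) \<and>
        (\<exists>C. \<forall>u\<in>L2 m. l2_norm n (T u) \<le> C * l2_norm m u)}"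

definition op_zero :: "'a measure \<Rightarrow> 'b measure \<Rightarrow> ('a, 'b) l2_op" where
  "op_zero m n = (\<lambda>u\<in>L2 m. l2_zero n)"

definition op_add ::
  "'a measure \<Rightarrow> 'b measure \<Rightarrow> ('a, 'b) l2_op \<Rightarrow> ('a, 'b) l2_op \<Rightarrow> ('a, 'b) l2_op" where
  "op_add m n S T = (\<lambda>u\<in>L2 m. l2_add n (S u) (T u))"

definition op_scale ::
  "'a measure \<Rightarrow> 'b measure \<Rightarrow> complex \<Rightarrow> ('a, 'b) l2_op \<Rightarrow> ('a, 'b) l2_op" where
  "op_scale m n c T = (\<lambda>u\<in>L2 m. l2_scale n c (T u))"

definition op_subspace :: "'a measure \<Rightarrow> 'b measure \<Rightarrow> ('a, 'b) l2_op set \<Rightarrow> bool" where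
  "op_subspace m n U \<longleftrightarrow>
     U \<subseteq> bounded_ops m n \<and> op_zero m n \<in> U \<and>
     (\<forall>S\<in>U. \<forall>T\<in>U. op_add m n S T \<in> U) \<and> (\<forall>c. \<forall>T\<in>U. op_scale m n c T \<in> U)"

definition op_set_plus ::
  "'a measure \<Rightarrow> 'b measure \<Rightarrow> ('a, 'b) l2_op set \<Rightarrow> ('a, 'b) l2_op set \<Rightarrow> ('a, 'b) l2_op set" where
  "op_set_plus m n U V = {op_add m n S T | S T. S \<in> U \<and> T \<in> V}"

definition projections :: "'a measure \<Rightarrow> ('a, 'a) l2_op set" where
  "projections m =
     {P \<in> bounded_ops m m.
        compose (L2 m) P P = P \<and>
        (\<forall>u\<in>L2 m. \<forall>v\<in>L2 m. l2_inner m (P u) v = l2_inner m u (P v))}"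

definition mult_op :: "'a measure \<Rightarrow> ('a \<Rightarrow> complex) \<Rightarrow> ('a, 'a) l2_op" where
  "mult_op m \<phi> = (\<lambda>u\<in>L2 m. ae_class m (\<lambda>x. \<phi> x * l2_rep u x))"

definition mult_masa :: "'a measure \<Rightarrow> ('a, 'a) l2_op set" where
  "mult_masa m = mult_op m ` {\<phi> \<in> borel_measurable m. \<exists>C. AE x in m. cmod (\<phi> x) \<le> C}"

definition char_proj :: "'a measure \<Rightarrow> 'a set \<Rightarrow> ('a, 'a) l2_op" where
  "char_proj m \<alpha> = mult_op m (indicator \<alpha>)"

text \<open>
  The ultraweak topology is the weak topology of the functionals
  \<open>T \<mapsto> \<Sum>k. \<langle>T x\<^sub>k, y\<^sub>k\<rangle>\<close> with \<open>\<Sum>k. \<parallel>x\<^sub>k\<parallel>\<^sup>2 < \<infinity>\<close> and \<open>\<Sum>k. \<parallel>y\<^sub>k\<parallel>\<^sup>2 < \<infinity>\<close>.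
\<close>

definition l2_square_summable :: "'a measure \<Rightarrow> (nat \<Rightarrow> ('a \<Rightarrow> complex) set) \<Rightarrow> bool" where
  "l2_square_summable m x \<longleftrightarrow> range x \<subseteq> L2 m \<and> summable (\<lambda>k. (l2_norm m (x k))\<^sup>2)"

definition ultraweak_topology :: "'a measure \<Rightarrow> 'b measure \<Rightarrow> ('a, 'b) l2_op topology" where
  "ultraweak_topology m n =
     topology_generated_by
       {{T \<in> bounded_ops m n. (\<Sum>k. l2_inner n (T (x k)) (y k)) \<in> G} | x y G.
          l2_square_summable m x \<and> l2_square_summable n y \<and> open (G :: complex set)}"


section \<open>Supports, maps of subspaces and synthetic sets\<close>

definition marginally_null :: "'a measure \<Rightarrow> 'b measure \<Rightarrow> ('a \<times> 'b) set \<Rightarrow> bool" where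
  "marginally_null m n E \<longleftrightarrow>
     (\<exists>A\<in>null_sets m. \<exists>B\<in>null_sets n. E \<subseteq> A \<times> space n \<union> space m \<times> B)"

definition M_max :: "'a measure \<Rightarrow> 'b measure \<Rightarrow> ('a \<times> 'b) set \<Rightarrow> ('a, 'b) l2_op set" where
  "M_max m n \<kappa> =
     {T \<in> bounded_ops m n. \<forall>\<alpha>\<in>sets m. \<forall>\<beta>\<in>sets n.
        marginally_null m n ((\<alpha> \<times> \<beta>) \<inter> \<kappa>) \<longrightarrow>
        compose (L2 m) (char_proj n \<beta>) (compose (L2 m) T (char_proj m \<alpha>)) = op_zero m n}"

definition op_Map :: "'a measure \<Rightarrow> 'b measure \<Rightarrow> ('a, 'b) l2_op set \<Rightarrow> ('a, 'a) l2_op \<Rightarrow> ('b, 'b) l2_op"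
  where
  "op_Map m n U =
     (\<lambda>P\<in>projections m. THE Q. Q \<in> projections n \<and>
        Q ` L2 n = l2_closed_span n {S u | S u. S \<in> U \<and> u \<in> P ` L2 m})"

definition masa_bimodule :: "'a measure \<Rightarrow> 'b measure \<Rightarrow> ('a, 'b) l2_op set \<Rightarrow> bool" where
  "masa_bimodule m n U \<longleftrightarrow>
     (\<forall>B\<in>mult_masa n. \<forall>T\<in>U. \<forall>A\<in>mult_masa m. compose (L2 m) B (compose (L2 m) T A) \<in> U)"

definition synthetic :: "'a measure \<Rightarrow> 'b measure \<Rightarrow> ('a \<times> 'b) set \<Rightarrow> bool" where
  "synthetic m n \<kappa> \<longleftrightarrow>
     (\<forall>U. op_subspace m n U \<and> closedin (ultraweak_topology m n) U \<and> masa_bimodule m n U \<and>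
         op_Map m n U = op_Map m n (M_max m n \<kappa>)
        \<longleftrightarrow> U = M_max m n \<kappa>)"

end

theory Submission
  imports Defs
begin

text \<open>
  Write \<open>M\<^sub>1\<close>, \<open>M\<^sub>2\<close>, \<open>M\<close> for the spaces of operators supported on \<open>\<kappa>\<^sub>1\<close>, \<open>\<kappa>\<^sub>2\<close> and
  \<open>\<kappa> = \<kappa>\<^sub>1 \<union> \<kappa>\<^sub>2\<close>, and call \<open>P(\<beta>) T P(\<alpha>)\<close> the block of \<open>T\<close> over the rectangle \<open>\<alpha> \<times> \<beta>\<close>.

  The map of a bimodule is a statement about blocks. For a finite measure, a closed subspace of the
  Hilbert space that is invariant under all bounded multiplications is the range of some \<open>P(\<beta>)\<close>
  (\<open>masa_invariant_subspace\<close>). Hence the projections in the definition of the map exist, and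
  two bimodules have the same map exactly if they vanish on the same rectangles, that is, if the
  same rectangles carry no nonzero block of their elements (\<open>op_Map_eq_iff\<close>). Synthesis of a set thus
  says that its maximal bimodule is the only ultraweakly closed bimodule vanishing on the same
  rectangles (\<open>synthetic_iff_vanishes_on\<close>).

  Everything else rests on one remark: if \<open>T \<in> M\<close> and the rectangle \<open>\<alpha> \<times> \<beta>\<close> meets \<open>\<kappa>\<^sub>1\<close> in a
  marginally null set, then the block of \<open>T\<close> over it is supported on \<open>\<kappa>\<^sub>2\<close>
  (\<open>block_in_M_max_of_Un\<close>). An operator in \<open>M\<close> that is not in \<open>M\<^sub>1\<close> therefore has a nonzero block in
  \<open>M\<^sub>2\<close>; so \<open>M\<close> vanishes wherever both \<open>M\<^sub>1\<close> and \<open>M\<^sub>2\<close> do (\<open>vanishes_on_M_max_Un\<close>).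

  If \<open>\<kappa>\<close> is synthetic, this remark shows that the ultraweak closure of \<open>M\<^sub>1 + M\<^sub>2\<close>, a closed
  bimodule, has the map of \<open>M\<close>, so it equals \<open>M\<close>.

  Conversely, let \<open>M\<^sub>1 + M\<^sub>2\<close> be dense in \<open>M\<close> and let \<open>V\<close> be a closed bimodule with the map of \<open>M\<close>.
  Then \<open>V \<subseteq> M\<close>, and it is enough to show \<open>M\<^sub>1 \<subseteq> V\<close> and \<open>M\<^sub>2 \<subseteq> V\<close>. By synthesis of \<open>\<kappa>\<^sub>1\<close> the first
  inclusion follows once \<open>M\<^sub>1\<close> vanishes wherever \<open>V \<inter> M\<^sub>1\<close> does. On a rectangle where \<open>V \<inter> M\<^sub>1\<close>
  vanishes, the blocks of \<open>V\<close> lie in \<open>M\<^sub>2\<close>, and since \<open>V\<close> and \<open>M\<close> vanish on the same smaller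
  rectangles, so do the blocks of \<open>M\<close>, in particular those of \<open>M\<^sub>1\<close>. Synthesis of \<open>\<kappa>\<^sub>2\<close>, applied to the bimodule of all \<open>S \<in> M\<^sub>2\<close> whose
  block over this rectangle is in \<open>V\<close>, puts the blocks of \<open>M\<^sub>2\<close> into \<open>V\<close>. So a block of \<open>M\<^sub>1\<close> is in
  \<open>V \<inter> M\<^sub>1\<close> and has to vanish (\<open>synthetic_piece_subset\<close>).
\<close>

section \<open>Square-integrable classes\<close>

lemma square_integrable_measurable [measurable_dest]:
  "square_integrable m f \<Longrightarrow> f \<in> borel_measurable m"
  by (simp add: square_integrable_def)

lemma square_integrable_cong_AE:
  assumes "AE x in m. f x = g x" "f \<in> borel_measurable m" "square_integrable m g"
  shows "square_integrable m f"
proof -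
  have [measurable]: "f \<in> borel_measurable m" "g \<in> borel_measurable m"
    using assms by (auto simp: square_integrable_def)
  have "integrable m (\<lambda>x. (cmod (f x))\<^sup>2) = integrable m (\<lambda>x. (cmod (g x))\<^sup>2)"
    by (rule integrable_cong_AE) (use assms(1) in auto)
  then show ?thesis
    using assms by (simp add: square_integrable_def)
qed

lemma square_integrable_dominated:
  assumes "square_integrable m f" "g \<in> borel_measurable m" "AE x in m. cmod (g x) \<le> C * cmod (f x)"
  shows "square_integrable m g"
proof -
  have [measurable]: "f \<in> borel_measurable m" "g \<in> borel_measurable m"
    using assms by (auto simp: square_integrable_def)
  have "integrable m (\<lambda>x. C\<^sup>2 * (cmod (f x))\<^sup>2)"
    using assms(1) by (simp add: square_integrable_def)
  then have "integrable m (\<lambda>x. (cmod (g x))\<^sup>2)"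
  proof (rule Bochner_Integration.integrable_bound)
    show "AE x in m. norm ((cmod (g x))\<^sup>2) \<le> norm (C\<^sup>2 * (cmod (f x))\<^sup>2)"
      using assms(3)
    proof eventually_elim
      case (elim x)
      have "(cmod (g x))\<^sup>2 \<le> (C * cmod (f x))\<^sup>2"
        by (rule power_mono) (use elim in auto)
      then show ?case by (simp add: power_mult_distrib)
    qed
  qed measurable
  then show ?thesis
    by (simp add: square_integrable_def)
qed

lemma square_integrable_add:
  assumes "square_integrable m f" "square_integrable m g"
  shows "square_integrable m (\<lambda>x. f x + g x)"
proof -
  have [measurable]: "f \<in> borel_measurable m" "g \<in> borel_measurable m"
    using assms by (auto simp: square_integrable_def)
  have "integrable m (\<lambda>x. 2 * (cmod (f x))\<^sup>2 + 2 * (cmod (g x))\<^sup>2)"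
    using assms by (simp add: square_integrable_def)
  then have "integrable m (\<lambda>x. (cmod (f x + g x))\<^sup>2)"
  proof (rule Bochner_Integration.integrable_bound)
    show "AE x in m. norm ((cmod (f x + g x))\<^sup>2) \<le> norm (2 * (cmod (f x))\<^sup>2 + 2 * (cmod (g x))\<^sup>2)"
    proof (rule AE_I2)
      fix x
      have "(cmod (f x + g x))\<^sup>2 \<le> (cmod (f x) + cmod (g x))\<^sup>2"
        by (simp add: norm_triangle_ineq power_mono)
      also have "\<dots> \<le> 2 * (cmod (f x))\<^sup>2 + 2 * (cmod (g x))\<^sup>2"
        using sum_squares_bound[of "cmod (f x)" "cmod (g x)"] by (simp add: power2_sum)
      finally show "norm ((cmod (f x + g x))\<^sup>2) \<le> norm (2 * (cmod (f x))\<^sup>2 + 2 * (cmod (g x))\<^sup>2)"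
        by simp
    qed
  qed measurable
  then show ?thesis
    by (simp add: square_integrable_def)
qed

definition ess_bounded :: "'a measure \<Rightarrow> ('a \<Rightarrow> complex) \<Rightarrow> bool" where
  "ess_bounded m \<phi> \<longleftrightarrow> \<phi> \<in> borel_measurable m \<and> (\<exists>C. AE x in m. cmod (\<phi> x) \<le> C)"

lemma ess_boundedE:
  assumes "ess_bounded m \<phi>"
  obtains C where "0 \<le> C" "AE x in m. cmod (\<phi> x) \<le> C"
proof -
  obtain C where C: "AE x in m. cmod (\<phi> x) \<le> C"
    using assms by (auto simp: ess_bounded_def)
  show thesis
    by (rule that[of "max C 0"]) (use C in auto)
qed

lemma ess_bounded_const: "ess_bounded m (\<lambda>x. c)"
  by (auto simp: ess_bounded_def)

lemma ess_bounded_indicator: "\<alpha> \<in> sets m \<Longrightarrow> ess_bounded m (indicator \<alpha>)"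
  unfolding ess_bounded_def by (auto intro!: exI[of _ 1] AE_I2 split: split_indicator)

lemma ess_bounded_cnj: "ess_bounded m \<phi> \<Longrightarrow> ess_bounded m (\<lambda>x. cnj (\<phi> x))"
  unfolding ess_bounded_def
  by (auto intro!: borel_measurable_continuous_on[where f = cnj] continuous_intros)

lemma ess_bounded_mult:
  assumes "ess_bounded m \<phi>" "ess_bounded m \<psi>"
  shows "ess_bounded m (\<lambda>x. \<phi> x * \<psi> x)"
proof -
  obtain C D where C: "0 \<le> C" "AE x in m. cmod (\<phi> x) \<le> C" and D: "AE x in m. cmod (\<psi> x) \<le> D"
    using assms by (metis ess_boundedE)
  have "AE x in m. cmod (\<phi> x * \<psi> x) \<le> C * D"
    using C(2) D by eventually_elim (simp add: norm_mult mult_mono C)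
  then show ?thesis
    using assms by (auto simp: ess_bounded_def)
qed

lemma mult_masa_altdef: "mult_masa m = mult_op m ` {\<phi>. ess_bounded m \<phi>}"
  by (auto simp: mult_masa_def ess_bounded_def)

lemma square_integrable_mult:
  assumes "ess_bounded m \<phi>" "square_integrable m f"
  shows "square_integrable m (\<lambda>x. \<phi> x * f x)"
proof -
  obtain C where C: "0 \<le> C" "AE x in m. cmod (\<phi> x) \<le> C"
    by (rule ess_boundedE[OF assms(1)])
  have "AE x in m. cmod (\<phi> x * f x) \<le> C * cmod (f x)"
    using C(2) by eventually_elim (simp add: norm_mult mult_right_mono)
  then show ?thesis
    by (rule square_integrable_dominated[OF assms(2), rotated])
      (use assms in \<open>auto simp: ess_bounded_def square_integrable_def\<close>)
qed

lemma ae_class_in_L2: "square_integrable m f \<Longrightarrow> ae_class m f \<in> L2 m"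
  by (auto simp: L2_def)

lemma L2_rep:
  assumes "u \<in> L2 m"
  shows square_integrable_l2_rep: "square_integrable m (l2_rep u)"
    and ae_class_l2_rep: "ae_class m (l2_rep u) = u"
proof -
  obtain f where f: "square_integrable m f" "u = ae_class m f"
    using assms by (auto simp: L2_def)
  have fm: "f \<in> borel_measurable m"
    using f by (simp add: square_integrable_def)
  show "square_integrable m (l2_rep u)"
    using l2_rep_ae_class[OF fm] f square_integrable_cong_AE by blast
  show "ae_class m (l2_rep u) = u"
    using l2_rep_ae_class[OF fm] f ae_class_cong by metis
qed

lemma l2_rep_measurable [measurable]: "u \<in> L2 m \<Longrightarrow> l2_rep u \<in> borel_measurable m"
  using square_integrable_l2_rep square_integrable_measurable by blast

text \<open>
  Algebraic identities between classes are verified through this rule: the rules \<open>AE_rep_zero\<close>,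
  \<open>AE_rep_add\<close>, \<open>AE_rep_scale\<close> and \<open>AE_rep_mult_op\<close> turn them into pointwise identities.
\<close>

lemma L2_eqI:
  assumes "u \<in> L2 m" "v \<in> L2 m" "AE x in m. l2_rep u x = l2_rep v x"
  shows "u = v"
  using assms ae_class_cong ae_class_l2_rep by metis

lemma l2_zero_in_L2 [simp]: "l2_zero m \<in> L2 m"
  unfolding l2_zero_def by (rule ae_class_in_L2) (simp add: square_integrable_def)

lemma l2_add_in_L2 [simp]: "u \<in> L2 m \<Longrightarrow> v \<in> L2 m \<Longrightarrow> l2_add m u v \<in> L2 m"
  unfolding l2_add_def
  by (intro ae_class_in_L2 square_integrable_add square_integrable_l2_rep)

lemma mult_op_in_L2 [simp]: "ess_bounded m \<phi> \<Longrightarrow> u \<in> L2 m \<Longrightarrow> mult_op m \<phi> u \<in> L2 m"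
  by (simp add: mult_op_def ae_class_in_L2 square_integrable_mult square_integrable_l2_rep)

lemma l2_scale_eq_mult_op: "u \<in> L2 m \<Longrightarrow> l2_scale m c u = mult_op m (\<lambda>x. c) u"
  by (simp add: l2_scale_def mult_op_def)

lemma l2_scale_in_L2 [simp]: "u \<in> L2 m \<Longrightarrow> l2_scale m c u \<in> L2 m"
  by (simp add: l2_scale_eq_mult_op ess_bounded_const)

lemma AE_rep_zero: "AE x in m. l2_rep (l2_zero m) x = 0"
  unfolding l2_zero_def by (rule l2_rep_ae_class(2)) simp

lemma AE_rep_add:
  "u \<in> L2 m \<Longrightarrow> v \<in> L2 m \<Longrightarrow> AE x in m. l2_rep (l2_add m u v) x = l2_rep u x + l2_rep v x"
  unfolding l2_add_def by (rule l2_rep_ae_class(2)) simp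

lemma AE_rep_scale:
  "u \<in> L2 m \<Longrightarrow> AE x in m. l2_rep (l2_scale m c u) x = c * l2_rep u x"
  unfolding l2_scale_def by (rule l2_rep_ae_class(2)) simp

lemma AE_rep_mult_op:
  "ess_bounded m \<phi> \<Longrightarrow> u \<in> L2 m \<Longrightarrow> AE x in m. l2_rep (mult_op m \<phi> u) x = \<phi> x * l2_rep u x"
  by (simp add: mult_op_def) (rule l2_rep_ae_class(2), auto simp: ess_bounded_def)

lemma l2_add_commute: "l2_add m u v = l2_add m v u"
  by (simp add: l2_add_def add.commute)

lemma l2_add_assoc:
  assumes "u \<in> L2 m" "v \<in> L2 m" "w \<in> L2 m"
  shows "l2_add m (l2_add m u v) w = l2_add m u (l2_add m v w)"
proof (rule L2_eqI[of _ m])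
  show "AE x in m. l2_rep (l2_add m (l2_add m u v) w) x = l2_rep (l2_add m u (l2_add m v w)) x"
    using AE_rep_add[of "l2_add m u v" m w] AE_rep_add[of u m v]
      AE_rep_add[of u m "l2_add m v w"] AE_rep_add[of v m w] assms by force
qed (use assms in auto)

lemma l2_add_zero [simp]:
  assumes "u \<in> L2 m"
  shows "l2_add m (l2_zero m) u = u" "l2_add m u (l2_zero m) = u"
proof -
  show *: "l2_add m (l2_zero m) u = u"
    by (rule L2_eqI[of _ m])
      (use AE_rep_add[of "l2_zero m" m u] AE_rep_zero[of m] assms in auto)
  then show "l2_add m u (l2_zero m) = u"
    by (simp add: l2_add_commute)
qed

lemma l2_add_neg:
  assumes "u \<in> L2 m"
  shows "l2_add m u (l2_scale m (-1) u) = l2_zero m"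
  by (rule L2_eqI[of _ m])
    (use AE_rep_add[of u m "l2_scale m (-1) u"] AE_rep_scale[of u m "-1"] AE_rep_zero[of m] assms in auto)

lemma mult_op_add:
  assumes "ess_bounded m \<phi>" "u \<in> L2 m" "v \<in> L2 m"
  shows "mult_op m \<phi> (l2_add m u v) = l2_add m (mult_op m \<phi> u) (mult_op m \<phi> v)"
proof (rule L2_eqI[of _ m])
  show "AE x in m. l2_rep (mult_op m \<phi> (l2_add m u v)) x
      = l2_rep (l2_add m (mult_op m \<phi> u) (mult_op m \<phi> v)) x"
    using AE_rep_mult_op[of m \<phi> "l2_add m u v"] AE_rep_add[of u m v]
      AE_rep_add[of "mult_op m \<phi> u" m "mult_op m \<phi> v"]
      AE_rep_mult_op[of m \<phi> u] AE_rep_mult_op[of m \<phi> v] assms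
    by (force simp: algebra_simps)
qed (use assms in auto)

lemma mult_op_mult_op:
  assumes "ess_bounded m \<phi>" "ess_bounded m \<psi>" "u \<in> L2 m"
  shows "mult_op m \<phi> (mult_op m \<psi> u) = mult_op m (\<lambda>x. \<phi> x * \<psi> x) u"
proof (rule L2_eqI[of _ m])
  show "AE x in m. l2_rep (mult_op m \<phi> (mult_op m \<psi> u)) x = l2_rep (mult_op m (\<lambda>x. \<phi> x * \<psi> x) u) x"
    using AE_rep_mult_op[of m \<phi> "mult_op m \<psi> u"] AE_rep_mult_op[of m \<psi> u]
      AE_rep_mult_op[OF ess_bounded_mult[OF assms(1,2)], of u] assms
    by (force simp: algebra_simps)
qed (use assms ess_bounded_mult[OF assms(1,2)] in auto)

lemma mult_op_scale:
  assumes "ess_bounded m \<phi>" "u \<in> L2 m"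
  shows "mult_op m \<phi> (l2_scale m c u) = l2_scale m c (mult_op m \<phi> u)"
  using assms by (simp add: l2_scale_eq_mult_op mult_op_mult_op ess_bounded_const mult.commute)

lemma l2_scale_add:
  "u \<in> L2 m \<Longrightarrow> v \<in> L2 m \<Longrightarrow> l2_scale m c (l2_add m u v) = l2_add m (l2_scale m c u) (l2_scale m c v)"
  by (simp add: l2_scale_eq_mult_op mult_op_add ess_bounded_const)

lemma mult_op_zero: "ess_bounded m \<phi> \<Longrightarrow> mult_op m \<phi> (l2_zero m) = l2_zero m"
  by (rule L2_eqI[of _ m])
    (use AE_rep_mult_op[of m \<phi> "l2_zero m"] AE_rep_zero[of m] in auto)

lemma l2_scale_zero: "l2_scale m c (l2_zero m) = l2_zero m"
  by (simp add: l2_scale_eq_mult_op mult_op_zero ess_bounded_const)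

lemma mult_op_one: "u \<in> L2 m \<Longrightarrow> mult_op m (\<lambda>x. 1) u = u"
  by (rule L2_eqI[of _ m]) (use AE_rep_mult_op[OF ess_bounded_const, of u m 1] in \<open>auto simp: ess_bounded_const\<close>)

lemma mult_op_const_zero: "u \<in> L2 m \<Longrightarrow> mult_op m (\<lambda>x. 0) u = l2_zero m"
  by (simp add: mult_op_def l2_zero_def)

lemma l2_scale_0: "u \<in> L2 m \<Longrightarrow> l2_scale m 0 u = l2_zero m"
  by (simp add: l2_scale_eq_mult_op mult_op_const_zero)


subsection \<open>Norm, distance and inner product\<close>

lemma integrable_norm_square: "u \<in> L2 m \<Longrightarrow> integrable m (\<lambda>x. (cmod (l2_rep u x))\<^sup>2)"
  using square_integrable_l2_rep by (auto simp: square_integrable_def)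

lemma l2_norm_nonneg: "0 \<le> l2_norm m u"
  by (simp add: l2_norm_def)

lemma l2_norm_square: "(l2_norm m u)\<^sup>2 = (LINT x|m. (cmod (l2_rep u x))\<^sup>2)"
  by (simp add: l2_norm_def)

lemma l2_norm_eq_0_iff:
  assumes "u \<in> L2 m"
  shows "l2_norm m u = 0 \<longleftrightarrow> u = l2_zero m"
proof
  assume "l2_norm m u = 0"
  then have "(LINT x|m. (cmod (l2_rep u x))\<^sup>2) = 0"
    by (simp add: l2_norm_def)
  then have "AE x in m. (cmod (l2_rep u x))\<^sup>2 = 0"
    by (subst (asm) integral_nonneg_eq_0_iff_AE[OF integrable_norm_square[OF assms]]) auto
  then show "u = l2_zero m"
    by (intro L2_eqI[of _ m]) (use AE_rep_zero[of m] assms in auto)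
next
  assume "u = l2_zero m"
  then show "l2_norm m u = 0"
    by (simp add: l2_zero_def l2_norm_ae_class)
qed

lemma l2_norm_mult_op_le:
  assumes "ess_bounded m \<phi>" "0 \<le> C" "AE x in m. cmod (\<phi> x) \<le> C" "u \<in> L2 m"
  shows "l2_norm m (mult_op m \<phi> u) \<le> C * l2_norm m u"
proof -
  have "(LINT x|m. (cmod (l2_rep (mult_op m \<phi> u) x))\<^sup>2) \<le> (LINT x|m. C\<^sup>2 * (cmod (l2_rep u x))\<^sup>2)"
  proof (rule integral_mono_AE)
    show "AE x in m. (cmod (l2_rep (mult_op m \<phi> u) x))\<^sup>2 \<le> C\<^sup>2 * (cmod (l2_rep u x))\<^sup>2"
      using AE_rep_mult_op[OF assms(1,4)] assms(3)
    proof eventually_elim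
      case (elim x)
      have "cmod (\<phi> x * l2_rep u x) \<le> C * cmod (l2_rep u x)"
        using elim by (simp add: norm_mult mult_right_mono)
      then have "(cmod (\<phi> x * l2_rep u x))\<^sup>2 \<le> (C * cmod (l2_rep u x))\<^sup>2"
        by (rule power_mono) simp
      then show ?case
        using elim by (simp add: power_mult_distrib)
    qed
  qed (intro integrable_norm_square integrable_mult_right mult_op_in_L2 assms)+
  then have "(l2_norm m (mult_op m \<phi> u))\<^sup>2 \<le> (C * l2_norm m u)\<^sup>2"
    by (simp add: l2_norm_square power_mult_distrib)
  then show ?thesis
    by (rule power2_le_imp_le) (simp add: assms(2) l2_norm_nonneg)
qed

text \<open>
  Minkowski's inequality by optimising over weights: \<open>(a + b)\<^sup>2 \<le> (1 + t) a\<^sup>2 + (1 + 1/t) b\<^sup>2\<close> holds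
  pointwise for every \<open>t > 0\<close>, and after integration the ratio of the two norms is the best \<open>t\<close>.
\<close>

lemma l2_norm_triangle:
  assumes "u \<in> L2 m" "v \<in> L2 m"
  shows "l2_norm m (l2_add m u v) \<le> l2_norm m u + l2_norm m v"
proof (cases "u = l2_zero m \<or> v = l2_zero m")
  case True
  then show ?thesis
    using assms l2_norm_nonneg by auto
next
  case False
  define a b where "a = l2_norm m u" and "b = l2_norm m v"
  have pos: "a > 0" "b > 0"
    using False assms l2_norm_nonneg[of m u] l2_norm_nonneg[of m v]
      l2_norm_eq_0_iff[of u m] l2_norm_eq_0_iff[of v m]
    by (auto simp: a_def b_def)
  have "(LINT x|m. (cmod (l2_rep (l2_add m u v) x))\<^sup>2)
      \<le> (LINT x|m. (1 + b / a) * (cmod (l2_rep u x))\<^sup>2 + (1 + a / b) * (cmod (l2_rep v x))\<^sup>2)"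
  proof (rule integral_mono_AE)
    show "AE x in m. (cmod (l2_rep (l2_add m u v) x))\<^sup>2
        \<le> (1 + b / a) * (cmod (l2_rep u x))\<^sup>2 + (1 + a / b) * (cmod (l2_rep v x))\<^sup>2"
      using AE_rep_add[OF assms]
    proof eventually_elim
      case (elim x)
      define s t where "s = cmod (l2_rep u x)" and "t = cmod (l2_rep v x)"
      have "0 \<le> (b * s - a * t)\<^sup>2 / (a * b)"
        using pos by simp
      also have "\<dots> = b / a * s\<^sup>2 + a / b * t\<^sup>2 - 2 * s * t"
        using pos by (simp add: field_simps power2_eq_square)
      finally have "(s + t)\<^sup>2 \<le> (1 + b / a) * s\<^sup>2 + (1 + a / b) * t\<^sup>2"
        by (simp add: power2_sum algebra_simps)
      moreover have "(cmod (l2_rep u x + l2_rep v x))\<^sup>2 \<le> (s + t)\<^sup>2"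
        by (simp add: s_def t_def norm_triangle_ineq power_mono)
      ultimately show ?case
        unfolding elim s_def t_def by linarith
    qed
  qed (intro integrable_norm_square Bochner_Integration.integrable_add Bochner_Integration.integrable_mult_right l2_add_in_L2 assms)+
  also have "\<dots> = (1 + b / a) * a\<^sup>2 + (1 + a / b) * b\<^sup>2"
    using assms by (simp add: integrable_norm_square a_def b_def l2_norm_square)
  also have "\<dots> = (a + b)\<^sup>2"
    using pos by (simp add: field_simps power2_eq_square)
  finally have "(l2_norm m (l2_add m u v))\<^sup>2 \<le> (a + b)\<^sup>2"
    by (simp add: l2_norm_square)
  then show ?thesis
    using pos by (simp add: a_def b_def power2_le_imp_le[of "l2_norm m (l2_add m u v)"])
qed

lemma l2_dist_eq_norm:
  assumes "u \<in> L2 m" "v \<in> L2 m"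
  shows "l2_dist m u v = l2_norm m (l2_add m u (l2_scale m (-1) v))"
proof -
  have "(LINT x|m. (cmod (l2_rep u x - l2_rep v x))\<^sup>2)
      = (LINT x|m. (cmod (l2_rep (l2_add m u (l2_scale m (-1) v)) x))\<^sup>2)"
  proof (rule integral_cong_AE)
    show "AE x in m. (cmod (l2_rep u x - l2_rep v x))\<^sup>2
        = (cmod (l2_rep (l2_add m u (l2_scale m (-1) v)) x))\<^sup>2"
      using AE_rep_add[OF assms(1) l2_scale_in_L2[OF assms(2), of "-1"]] AE_rep_scale[OF assms(2), of "-1"]
      by auto
  qed (use assms l2_add_in_L2 l2_scale_in_L2 in measurable)
  then show ?thesis
    by (simp add: l2_dist_def l2_norm_def)
qed

lemma l2_dist_eq_0_iff:
  assumes "u \<in> L2 m" "v \<in> L2 m"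
  shows "l2_dist m u v = 0 \<longleftrightarrow> u = v"
proof -
  have "u = v" if "l2_add m u (l2_scale m (-1) v) = l2_zero m"
  proof (rule L2_eqI[OF assms])
    have "AE x in m. l2_rep (l2_add m u (l2_scale m (-1) v)) x = 0"
      using that AE_rep_zero by simp
    then show "AE x in m. l2_rep u x = l2_rep v x"
      using AE_rep_add[OF assms(1) l2_scale_in_L2[OF assms(2), of "-1"]] AE_rep_scale[OF assms(2), of "-1"]
      by auto
  qed
  then show ?thesis
    using assms by (auto simp: l2_dist_eq_norm l2_norm_eq_0_iff l2_add_neg)
qed

lemma Metric_space_L2: "Metric_space (L2 m) (l2_dist m)"
proof
  show "0 \<le> l2_dist m u v" for u v
    by (simp add: l2_dist_def)
  show "l2_dist m u v = l2_dist m v u" for u v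
    by (simp add: l2_dist_def norm_minus_commute)
  show "l2_dist m u v = 0 \<longleftrightarrow> u = v" if "u \<in> L2 m" "v \<in> L2 m" for u v
    using that by (rule l2_dist_eq_0_iff)
  show "l2_dist m u w \<le> l2_dist m u v + l2_dist m v w"
    if "u \<in> L2 m" "v \<in> L2 m" "w \<in> L2 m" for u v w
  proof -
    let ?n = "l2_scale m (-1)"
    have "l2_add m u (?n w) = l2_add m (l2_add m u (?n v)) (l2_add m v (?n w))"
    proof -
      have "l2_add m (l2_add m u (?n v)) (l2_add m v (?n w))
          = l2_add m u (l2_add m (l2_add m v (?n v)) (?n w))"
        using that by (simp add: l2_add_assoc l2_add_commute[of m v "?n v"])
      also have "\<dots> = l2_add m u (?n w)"
        using that by (simp add: l2_add_neg)
      finally show ?thesis by simp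
    qed
    then show ?thesis
      using that l2_norm_triangle[of "l2_add m u (?n v)" m "l2_add m v (?n w)"]
      by (simp add: l2_dist_eq_norm)
  qed
qed

text \<open>
  Weaker than the Cauchy-Schwarz inequality, but the sum of squares on the right-hand side is the
  form that the convergence of the series in an ultraweak functional asks for.
\<close>

lemma l2_inner_bound:
  assumes "u \<in> L2 m" "v \<in> L2 m"
  shows integrable_l2_inner: "integrable m (\<lambda>x. l2_rep u x * cnj (l2_rep v x))"
    and norm_l2_inner_le: "cmod (l2_inner m u v) \<le> (l2_norm m u)\<^sup>2 + (l2_norm m v)\<^sup>2"
proof -
  note [measurable] = l2_rep_measurable[OF assms(1)] l2_rep_measurable[OF assms(2)]
  have meas [measurable]: "(\<lambda>x. l2_rep u x * cnj (l2_rep v x)) \<in> borel_measurable m"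
    by (intro borel_measurable_times borel_measurable_continuous_on[where f = cnj])
      (auto intro: continuous_intros)
  have le: "cmod (l2_rep u x * cnj (l2_rep v x)) \<le> (cmod (l2_rep u x))\<^sup>2 + (cmod (l2_rep v x))\<^sup>2" for x
  proof -
    have "2 * (cmod (l2_rep u x) * cmod (l2_rep v x)) \<le> (cmod (l2_rep u x))\<^sup>2 + (cmod (l2_rep v x))\<^sup>2"
      using sum_squares_bound[of "cmod (l2_rep u x)" "cmod (l2_rep v x)"] by simp
    moreover have "0 \<le> cmod (l2_rep u x) * cmod (l2_rep v x)"
      by simp
    ultimately show ?thesis
      unfolding norm_mult complex_mod_cnj by linarith
  qed
  have int: "integrable m (\<lambda>x. (cmod (l2_rep u x))\<^sup>2 + (cmod (l2_rep v x))\<^sup>2)"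
    by (intro Bochner_Integration.integrable_add integrable_norm_square assms)
  show i: "integrable m (\<lambda>x. l2_rep u x * cnj (l2_rep v x))"
    by (rule Bochner_Integration.integrable_bound[OF int meas]) (use le in \<open>auto intro: AE_I2\<close>)
  have "cmod (l2_inner m u v) \<le> (LINT x|m. cmod (l2_rep u x * cnj (l2_rep v x)))"
    unfolding l2_inner_def by (rule integral_norm_bound)
  also have "\<dots> \<le> (LINT x|m. (cmod (l2_rep u x))\<^sup>2 + (cmod (l2_rep v x))\<^sup>2)"
    by (rule integral_mono) (use int i le in auto)
  also have "\<dots> = (l2_norm m u)\<^sup>2 + (l2_norm m v)\<^sup>2"
    using assms by (simp add: l2_norm_square integrable_norm_square)
  finally show "cmod (l2_inner m u v) \<le> (l2_norm m u)\<^sup>2 + (l2_norm m v)\<^sup>2" .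
qed

lemma l2_inner_cong_AE:
  assumes "u \<in> L2 m" "v \<in> L2 m" "w \<in> borel_measurable m"
    and "AE x in m. l2_rep u x * cnj (l2_rep v x) = w x"
  shows "l2_inner m u v = (LINT x|m. w x)"
  unfolding l2_inner_def
  by (rule integral_cong_AE) (use assms integrable_l2_inner[of u m v] in auto)

lemma l2_inner_add:
  assumes "u \<in> L2 m" "v \<in> L2 m" "w \<in> L2 m"
  shows "l2_inner m (l2_add m u v) w = l2_inner m u w + l2_inner m v w"
proof -
  have int: "integrable m (\<lambda>x. l2_rep u x * cnj (l2_rep w x))" "integrable m (\<lambda>x. l2_rep v x * cnj (l2_rep w x))"
    using assms integrable_l2_inner by auto
  have "l2_inner m (l2_add m u v) w
      = (LINT x|m. l2_rep u x * cnj (l2_rep w x) + l2_rep v x * cnj (l2_rep w x))"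
  proof (rule l2_inner_cong_AE)
    show "AE x in m. l2_rep (l2_add m u v) x * cnj (l2_rep w x)
        = l2_rep u x * cnj (l2_rep w x) + l2_rep v x * cnj (l2_rep w x)"
      using AE_rep_add[of u m v] assms by (auto simp: algebra_simps)
  qed (use assms int in auto)
  also have "\<dots> = l2_inner m u w + l2_inner m v w"
    using int by (simp add: l2_inner_def)
  finally show ?thesis .
qed

lemma l2_inner_mult_op:
  assumes "ess_bounded m \<phi>" "u \<in> L2 m" "v \<in> L2 m"
  shows "l2_inner m (mult_op m \<phi> u) v = l2_inner m u (mult_op m (\<lambda>x. cnj (\<phi> x)) v)"
proof -
  have b: "ess_bounded m (\<lambda>x. cnj (\<phi> x))"
    using assms by (simp add: ess_bounded_cnj)
  have "l2_inner m (mult_op m \<phi> u) v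
      = (LINT x|m. l2_rep u x * cnj (l2_rep (mult_op m (\<lambda>x. cnj (\<phi> x)) v) x))"
  proof (rule l2_inner_cong_AE)
    show "AE x in m. l2_rep (mult_op m \<phi> u) x * cnj (l2_rep v x)
        = l2_rep u x * cnj (l2_rep (mult_op m (\<lambda>x. cnj (\<phi> x)) v) x)"
      using AE_rep_mult_op[OF assms(1,2)] AE_rep_mult_op[OF b assms(3)] by auto
  qed (use assms b integrable_l2_inner[of u m "mult_op m (\<lambda>x. cnj (\<phi> x)) v"] in auto)
  then show ?thesis
    by (simp add: l2_inner_def)
qed

lemma l2_inner_scale:
  assumes "u \<in> L2 m" "v \<in> L2 m"
  shows "l2_inner m (l2_scale m c u) v = c * l2_inner m u v"
proof -
  have "l2_inner m (l2_scale m c u) v = (LINT x|m. c * (l2_rep u x * cnj (l2_rep v x)))"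
    by (rule l2_inner_cong_AE)
      (use assms AE_rep_scale[of u m c] integrable_l2_inner[of u m v] in auto)
  then show ?thesis
    by (simp add: l2_inner_def)
qed

lemma l2_inner_self: "l2_inner m u u = complex_of_real ((l2_norm m u)\<^sup>2)"
proof -
  have "l2_inner m u u = (LINT x|m. complex_of_real ((cmod (l2_rep u x))\<^sup>2))"
    by (simp only: l2_inner_def complex_norm_square)
  also have "\<dots> = complex_of_real (LINT x|m. (cmod (l2_rep u x))\<^sup>2)"
    by (rule integral_complex_of_real)
  finally show ?thesis
    by (simp only: l2_norm_square)
qed

lemma L2_eqI_inner:
  assumes "u \<in> L2 m" "v \<in> L2 m" "\<And>w. w \<in> L2 m \<Longrightarrow> l2_inner m u w = l2_inner m v w"
  shows "u = v"
proof -
  let ?d = "l2_add m u (l2_scale m (-1) v)"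
  have "l2_inner m ?d ?d = 0"
    using assms by (simp add: l2_inner_add l2_inner_scale)
  then have "l2_norm m ?d = 0"
    by (simp add: l2_inner_self)
  then show ?thesis
    using assms l2_dist_eq_norm l2_dist_eq_0_iff by metis
qed

section \<open>Bounded operators and closed subspaces\<close>

lemma bounded_ops_in_L2: "T \<in> bounded_ops m n \<Longrightarrow> u \<in> L2 m \<Longrightarrow> T u \<in> L2 n"
  by (auto simp: bounded_ops_def)

lemma bounded_ops_add:
  "T \<in> bounded_ops m n \<Longrightarrow> u \<in> L2 m \<Longrightarrow> v \<in> L2 m \<Longrightarrow> T (l2_add m u v) = l2_add n (T u) (T v)"
  by (simp add: bounded_ops_def)

lemma bounded_ops_scale:
  "T \<in> bounded_ops m n \<Longrightarrow> u \<in> L2 m \<Longrightarrow> T (l2_scale m c u) = l2_scale n c (T u)"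
  by (simp add: bounded_ops_def)

lemma bounded_ops_zero: 
  assumes "T \<in> bounded_ops m n"
  shows "T (l2_zero m) = l2_zero n"
proof -
  have "T (l2_scale m 0 (l2_zero m)) = l2_scale n 0 (T (l2_zero m))"
    by (rule bounded_ops_scale[OF assms]) simp
  then show ?thesis
    using bounded_ops_in_L2[OF assms, of "l2_zero m"] by (simp add: l2_scale_0)
qed

lemma bounded_opsE:
  assumes "T \<in> bounded_ops m n"
  obtains C where "0 \<le> C" "\<And>u. u \<in> L2 m \<Longrightarrow> l2_norm n (T u) \<le> C * l2_norm m u"
proof -
  obtain C where C: "\<forall>u\<in>L2 m. l2_norm n (T u) \<le> C * l2_norm m u"
    using assms by (auto simp: bounded_ops_def)
  show thesis
  proof (rule that[of "max C 0"])
    fix u assume "u \<in> L2 m"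
    then have "l2_norm n (T u) \<le> C * l2_norm m u"
      using C by blast
    also have "\<dots> \<le> max C 0 * l2_norm m u"
      by (rule mult_right_mono) (auto simp: l2_norm_nonneg)
    finally show "l2_norm n (T u) \<le> max C 0 * l2_norm m u" .
  qed simp
qed

lemma bounded_ops_eqI:
  assumes "S \<in> bounded_ops m n" "T \<in> bounded_ops m n" "\<And>u. u \<in> L2 m \<Longrightarrow> S u = T u"
  shows "S = T"
proof (rule PiE_ext)
  show "S \<in> L2 m \<rightarrow>\<^sub>E L2 n" "T \<in> L2 m \<rightarrow>\<^sub>E L2 n"
    using assms by (auto simp: bounded_ops_def)
qed (use assms in auto)

lemma bounded_opsI:
  assumes "T \<in> extensional (L2 m)"
    and "\<And>u. u \<in> L2 m \<Longrightarrow> T u \<in> L2 n"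
    and "\<And>u v. u \<in> L2 m \<Longrightarrow> v \<in> L2 m \<Longrightarrow> T (l2_add m u v) = l2_add n (T u) (T v)"
    and "\<And>c u. u \<in> L2 m \<Longrightarrow> T (l2_scale m c u) = l2_scale n c (T u)"
    and "\<And>u. u \<in> L2 m \<Longrightarrow> l2_norm n (T u) \<le> C * l2_norm m u"
  shows "T \<in> bounded_ops m n"
proof -
  have "\<exists>C. \<forall>u\<in>L2 m. l2_norm n (T u) \<le> C * l2_norm m u"
    using assms(5) by blast
  then show ?thesis
    using assms(1-4) by (simp add: bounded_ops_def PiE_def)
qed

lemma mult_op_bounded:
  assumes "ess_bounded m \<phi>"
  shows "mult_op m \<phi> \<in> bounded_ops m m"
proof -
  obtain C where C: "0 \<le> C" "AE x in m. cmod (\<phi> x) \<le> C"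
    by (rule ess_boundedE[OF assms])
  show ?thesis
  proof (rule bounded_opsI)
    show "mult_op m \<phi> \<in> extensional (L2 m)"
      by (simp add: mult_op_def)
    show "l2_norm m (mult_op m \<phi> u) \<le> C * l2_norm m u" if "u \<in> L2 m" for u
      using l2_norm_mult_op_le[OF assms C that] .
  qed (use assms in \<open>auto simp: mult_op_add mult_op_scale\<close>)
qed

lemma compose_bounded:
  assumes S: "S \<in> bounded_ops n k" and T: "T \<in> bounded_ops m n"
  shows "compose (L2 m) S T \<in> bounded_ops m k"
proof -
  obtain C where C: "0 \<le> C" "\<And>u. u \<in> L2 n \<Longrightarrow> l2_norm k (S u) \<le> C * l2_norm n u"
    using bounded_opsE[OF S] by blast
  obtain D where D: "0 \<le> D" "\<And>u. u \<in> L2 m \<Longrightarrow> l2_norm n (T u) \<le> D * l2_norm m u"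
    using bounded_opsE[OF T] by blast
  note T_in = bounded_ops_in_L2[OF T]
  show ?thesis
  proof (rule bounded_opsI)
    fix u assume u: "u \<in> L2 m"
    have "l2_norm k (S (T u)) \<le> C * l2_norm n (T u)"
      using C u T_in by blast
    also have "\<dots> \<le> C * (D * l2_norm m u)"
      using C D u by (intro mult_left_mono) auto
    finally show "l2_norm k (compose (L2 m) S T u) \<le> C * D * l2_norm m u"
      using u by (simp add: compose_eq)
  qed (use T_in bounded_ops_in_L2[OF S] in
        \<open>auto simp: compose_eq bounded_ops_add[OF T] bounded_ops_add[OF S]
          bounded_ops_scale[OF T] bounded_ops_scale[OF S]\<close>)
qed

lemma l2_norm_zero: "l2_norm m (l2_zero m) = 0"
  by (simp add: l2_norm_eq_0_iff)

lemma op_zero_bounded: "op_zero m n \<in> bounded_ops m n"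
  by (rule bounded_opsI[where C = 0])
    (simp_all add: op_zero_def l2_scale_zero l2_norm_zero)

lemma l2_add_swap:
  assumes "a \<in> L2 m" "b \<in> L2 m" "c \<in> L2 m" "d \<in> L2 m"
  shows "l2_add m (l2_add m a b) (l2_add m c d) = l2_add m (l2_add m a c) (l2_add m b d)"
proof -
  have "l2_add m (l2_add m a b) (l2_add m c d) = l2_add m a (l2_add m (l2_add m b c) d)"
    using assms by (simp add: l2_add_assoc)
  also have "\<dots> = l2_add m a (l2_add m (l2_add m c b) d)"
    by (simp add: l2_add_commute)
  finally show ?thesis
    using assms by (simp add: l2_add_assoc)
qed

lemma op_add_bounded:
  assumes S: "S \<in> bounded_ops m n" and T: "T \<in> bounded_ops m n"
  shows "op_add m n S T \<in> bounded_ops m n"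
proof -
  obtain C where C: "0 \<le> C" "\<And>u. u \<in> L2 m \<Longrightarrow> l2_norm n (S u) \<le> C * l2_norm m u"
    using bounded_opsE[OF S] by blast
  obtain D where D: "0 \<le> D" "\<And>u. u \<in> L2 m \<Longrightarrow> l2_norm n (T u) \<le> D * l2_norm m u"
    using bounded_opsE[OF T] by blast
  show ?thesis
  proof (rule bounded_opsI)
    fix u assume u: "u \<in> L2 m"
    show "l2_norm n (op_add m n S T u) \<le> (C + D) * l2_norm m u"
      using l2_norm_triangle[of "S u" n "T u"] C(2)[OF u] D(2)[OF u] u
        bounded_ops_in_L2[OF S] bounded_ops_in_L2[OF T]
      by (simp add: op_add_def algebra_simps)
  qed (use bounded_ops_in_L2[OF S] bounded_ops_in_L2[OF T] in
        \<open>auto simp: op_add_def bounded_ops_add[OF T] bounded_ops_add[OF S]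
          bounded_ops_scale[OF T] bounded_ops_scale[OF S] l2_scale_add l2_add_swap\<close>)
qed

lemma op_scale_eq_compose:
  assumes "T \<in> bounded_ops m n"
  shows "op_scale m n c T = compose (L2 m) (mult_op n (\<lambda>x. c)) T"
  using bounded_ops_in_L2[OF assms]
  by (auto simp: op_scale_def compose_def l2_scale_eq_mult_op intro!: restrict_ext)

lemma op_scale_bounded: "T \<in> bounded_ops m n \<Longrightarrow> op_scale m n c T \<in> bounded_ops m n"
  unfolding op_scale_eq_compose by (rule compose_bounded[OF mult_op_bounded[OF ess_bounded_const]])

definition closed_subspace :: "'a measure \<Rightarrow> ('a \<Rightarrow> complex) set set \<Rightarrow> bool" where
  "closed_subspace m V \<longleftrightarrow>
     l2_subspace m V \<and> closedin (Metric_space.mtopology (L2 m) (l2_dist m)) V"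

lemma closedin_L2_iff:
  "closedin (Metric_space.mtopology (L2 m) (l2_dist m)) V \<longleftrightarrow>
     V \<subseteq> L2 m \<and>
     (\<forall>\<sigma> u. range \<sigma> \<subseteq> V \<and> u \<in> L2 m \<and> (\<lambda>k. l2_dist m (\<sigma> k) u) \<longlonglongrightarrow> 0 \<longrightarrow> u \<in> V)"
proof -
  interpret Metric_space "L2 m" "l2_dist m"
    by (rule Metric_space_L2)
  show ?thesis
  proof (cases "V \<subseteq> L2 m")
    case True
    then have "limitin mtopology \<sigma> u sequentially \<longleftrightarrow> u \<in> L2 m \<and> (\<lambda>k. l2_dist m (\<sigma> k) u) \<longlonglongrightarrow> 0"
      if "range \<sigma> \<subseteq> V" for \<sigma> u
      using that by (subst limitin_metric_dist_null) (auto intro!: always_eventually)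
    then show ?thesis
      unfolding metric_closedin_iff_sequentially_closed by blast
  qed (simp add: metric_closedin_iff_sequentially_closed)
qed

lemma closed_subspaceD:
  assumes "closed_subspace m V"
  shows closed_subspace_subset: "V \<subseteq> L2 m"
    and closed_subspace_zero: "l2_zero m \<in> V"
    and closed_subspace_add: "u \<in> V \<Longrightarrow> v \<in> V \<Longrightarrow> l2_add m u v \<in> V"
    and closed_subspace_scale: "u \<in> V \<Longrightarrow> l2_scale m c u \<in> V"
    and closed_subspace_limit:
      "(\<And>k. \<sigma> k \<in> V) \<Longrightarrow> w \<in> L2 m \<Longrightarrow> (\<lambda>k. l2_dist m (\<sigma> k) w) \<longlonglongrightarrow> 0 \<Longrightarrow> w \<in> V"
proof -
  show "V \<subseteq> L2 m" "l2_zero m \<in> V" "u \<in> V \<Longrightarrow> v \<in> V \<Longrightarrow> l2_add m u v \<in> V"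
    "u \<in> V \<Longrightarrow> l2_scale m c u \<in> V"
    using assms by (simp_all add: closed_subspace_def l2_subspace_def)
  show "w \<in> V" if "\<And>k. \<sigma> k \<in> V" "w \<in> L2 m" "(\<lambda>k. l2_dist m (\<sigma> k) w) \<longlonglongrightarrow> 0"
  proof -
    have "range \<sigma> \<subseteq> V"
      using that(1) by auto
    then show ?thesis
      using assms that(2,3) unfolding closed_subspace_def closedin_L2_iff by blast
  qed
qed

lemma closed_subspaceI:
  assumes "V \<subseteq> L2 m" "l2_zero m \<in> V"
    and "\<And>u v. u \<in> V \<Longrightarrow> v \<in> V \<Longrightarrow> l2_add m u v \<in> V"
    and "\<And>c u. u \<in> V \<Longrightarrow> l2_scale m c u \<in> V"
    and "\<And>\<sigma> w. (\<And>k. \<sigma> k \<in> V) \<Longrightarrow> w \<in> L2 m \<Longrightarrow> (\<lambda>k. l2_dist m (\<sigma> k) w) \<longlonglongrightarrow> 0 \<Longrightarrow> w \<in> V"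
  shows "closed_subspace m V"
proof -
  have seq: "\<forall>\<sigma> w. range \<sigma> \<subseteq> V \<and> w \<in> L2 m \<and> (\<lambda>k. l2_dist m (\<sigma> k) w) \<longlonglongrightarrow> 0 \<longrightarrow> w \<in> V"
  proof (intro allI impI, elim conjE)
    fix \<sigma> w
    assume \<sigma>: "range \<sigma> \<subseteq> V" "w \<in> L2 m" "(\<lambda>k. l2_dist m (\<sigma> k) w) \<longlonglongrightarrow> 0"
    have "\<sigma> k \<in> V" for k
      using \<sigma>(1) by auto
    then show "w \<in> V"
      using assms(5) \<sigma>(2,3) by metis
  qed
  show ?thesis
    unfolding closed_subspace_def l2_subspace_def closedin_L2_iff
    using assms(1-4) seq by meson
qed

lemma closed_subspace_whole: "closed_subspace m (L2 m)"
  by (simp add: closed_subspace_def l2_subspace_def closedin_L2_iff)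

lemma closed_subspace_Inter:
  assumes "\<V> \<noteq> {}" "\<And>V. V \<in> \<V> \<Longrightarrow> closed_subspace m V"
  shows "closed_subspace m (\<Inter>\<V>)"
proof -
  have "closedin (Metric_space.mtopology (L2 m) (l2_dist m)) (\<Inter>\<V>)"
    using assms by (intro closedin_Inter) (auto simp: closed_subspace_def)
  moreover have "l2_subspace m (\<Inter>\<V>)"
    using assms unfolding closed_subspace_def l2_subspace_def by blast
  ultimately show ?thesis
    by (simp add: closed_subspace_def)
qed

lemma l2_closed_span_altdef: "l2_closed_span m S = \<Inter>{V. closed_subspace m V \<and> S \<subseteq> V}"
  by (simp add: l2_closed_span_def closed_subspace_def conj_assoc)

lemma l2_closed_span_superset: "S \<subseteq> l2_closed_span m S"
  by (auto simp: l2_closed_span_altdef)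

lemma l2_closed_span_minimal: "closed_subspace m V \<Longrightarrow> S \<subseteq> V \<Longrightarrow> l2_closed_span m S \<subseteq> V"
  by (auto simp: l2_closed_span_altdef)

lemma closed_subspace_l2_closed_span: "S \<subseteq> L2 m \<Longrightarrow> closed_subspace m (l2_closed_span m S)"
  unfolding l2_closed_span_altdef
  by (rule closed_subspace_Inter) (use closed_subspace_whole in blast)+

lemma l2_dist_bounded_ops:
  assumes "T \<in> bounded_ops m n" "u \<in> L2 m" "v \<in> L2 m"
  shows "l2_dist n (T u) (T v) = l2_norm n (T (l2_add m u (l2_scale m (-1) v)))"
  using assms by (simp add: l2_dist_eq_norm bounded_ops_in_L2 bounded_ops_add bounded_ops_scale)

text \<open>
  Bounded operators are Lipschitz for the distance. Kernels are the case \<open>V = {0}\<close>, and with \<open>T\<close> a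
  multiplication the lemma transfers invariance from a set to its closed span.
\<close>

lemma closed_subspace_vimage:
  assumes T: "T \<in> bounded_ops m n" and V: "closed_subspace n V"
  shows "closed_subspace m {u \<in> L2 m. T u \<in> V}"
proof -
  have "u \<in> {u \<in> L2 m. T u \<in> V}"
    if \<sigma>: "\<And>k. \<sigma> k \<in> {u \<in> L2 m. T u \<in> V}" and u: "u \<in> L2 m" and lim: "(\<lambda>k. l2_dist m (\<sigma> k) u) \<longlonglongrightarrow> 0"
    for \<sigma> u
  proof -
    have \<sigma>k: "\<sigma> k \<in> L2 m" "T (\<sigma> k) \<in> V" for k
      using \<sigma>[of k] by auto
    obtain C where C: "0 \<le> C" "\<And>u. u \<in> L2 m \<Longrightarrow> l2_norm n (T u) \<le> C * l2_norm m u"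
      using bounded_opsE[OF T] by blast
    have le: "l2_dist n (T (\<sigma> k)) (T u) \<le> C * l2_dist m (\<sigma> k) u" for k
      unfolding l2_dist_bounded_ops[OF T \<sigma>k(1) u] l2_dist_eq_norm[OF \<sigma>k(1) u]
      by (rule C(2)) (use \<sigma>k u in simp)
    have lim': "(\<lambda>k. C * l2_dist m (\<sigma> k) u) \<longlonglongrightarrow> 0"
      using tendsto_mult_left[OF lim, of C] by simp
    have nonneg: "0 \<le> l2_dist n v w" for v w
      by (simp add: l2_dist_def)
    have "(\<lambda>k. l2_dist n (T (\<sigma> k)) (T u)) \<longlonglongrightarrow> 0"
      by (rule tendsto_sandwich[OF _ _ tendsto_const lim'])
        (simp_all add: le nonneg)
    then have "T u \<in> V"
      using closed_subspace_limit[OF V, of "\<lambda>k. T (\<sigma> k)"] \<sigma>k bounded_ops_in_L2[OF T u] by blast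
    then show ?thesis
      using u by simp
  qed
  moreover have "{u \<in> L2 m. T u \<in> V} \<subseteq> L2 m"
    by blast
  ultimately show ?thesis
  proof (rule closed_subspaceI[rotated 4])
  qed (auto simp: bounded_ops_zero[OF T] bounded_ops_add[OF T] bounded_ops_scale[OF T]
        closed_subspace_zero[OF V] closed_subspace_add[OF V] closed_subspace_scale[OF V])
qed

lemma closed_subspace_zero_singleton: "closed_subspace m {l2_zero m}"
proof -
  interpret Metric_space "L2 m" "l2_dist m"
    by (rule Metric_space_L2)
  have "closedin mtopology {l2_zero m}"
    by (rule closedin_Hausdorff_singleton) (auto simp: Hausdorff_space_mtopology)
  then show ?thesis
    by (simp add: closed_subspace_def l2_subspace_def l2_scale_zero)
qed

lemma closed_subspace_kernel:
  "T \<in> bounded_ops m n \<Longrightarrow> closed_subspace m {u \<in> L2 m. T u = l2_zero n}"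
  using closed_subspace_vimage[OF _ closed_subspace_zero_singleton] by simp


section \<open>Closed subspaces invariant under a multiplication masa\<close>

text \<open>
  Dominated convergence, with the square of the modulus of the vector itself as the bound.
\<close>

lemma mult_op_indicator_limit:
  assumes u: "u \<in> L2 m" and A: "\<And>k. A k \<in> sets m" "incseq A"
  shows "(\<lambda>k. l2_dist m (mult_op m (indicator (A k)) u) (mult_op m (indicator (\<Union>k. A k)) u)) \<longlonglongrightarrow> 0"
proof -
  let ?f = "l2_rep u"
  have f: "?f \<in> borel_measurable m"
    using u by simp
  note A(1)[measurable] f[measurable]
  have [measurable]: "(\<Union>k. A k) \<in> sets m"
    by measurable
  have "(\<lambda>k. LINT x|m. (cmod (indicator (A k) x * ?f x - indicator (\<Union>k. A k) x * ?f x))\<^sup>2)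
      \<longlonglongrightarrow> (LINT x|m. 0)"
  proof (rule integral_dominated_convergence[where w = "\<lambda>x. (cmod (?f x))\<^sup>2"])
    show "integrable m (\<lambda>x. (cmod (?f x))\<^sup>2)"
      by (rule integrable_norm_square[OF u])
    show "AE x in m. (\<lambda>k. (cmod (indicator (A k) x * ?f x - indicator (\<Union>k. A k) x * ?f x))\<^sup>2) \<longlonglongrightarrow> 0"
    proof (rule AE_I2)
      fix x
      have "(\<lambda>k. indicator (A k) x :: complex) \<longlonglongrightarrow> indicator (\<Union>k. A k) x"
        by (rule LIMSEQ_indicator_incseq[OF A(2)])
      then have "(\<lambda>k. (cmod (indicator (A k) x * ?f x - indicator (\<Union>k. A k) x * ?f x))\<^sup>2) \<longlonglongrightarrow>
          (cmod (indicator (\<Union>k. A k) x * ?f x - indicator (\<Union>k. A k) x * ?f x))\<^sup>2"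
        by (intro tendsto_intros)
      then show "(\<lambda>k. (cmod (indicator (A k) x * ?f x - indicator (\<Union>k. A k) x * ?f x))\<^sup>2) \<longlonglongrightarrow> 0"
        by simp
    qed
    show "AE x in m. norm ((cmod (indicator (A k) x * ?f x - indicator (\<Union>k. A k) x * ?f x))\<^sup>2)
        \<le> (cmod (?f x))\<^sup>2" for k
      by (rule AE_I2) (auto split: split_indicator)
  qed measurable
  then have "(\<lambda>k. sqrt (LINT x|m. (cmod (indicator (A k) x * ?f x - indicator (\<Union>k. A k) x * ?f x))\<^sup>2))
      \<longlonglongrightarrow> sqrt 0"
    by (intro tendsto_real_sqrt) simp
  moreover have "l2_dist m (mult_op m (indicator (A k)) u) (mult_op m (indicator (\<Union>k. A k)) u)
      = sqrt (LINT x|m. (cmod (indicator (A k) x * ?f x - indicator (\<Union>k. A k) x * ?f x))\<^sup>2)" for k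
    using u by (simp add: mult_op_def) (rule l2_dist_ae_class, measurable)
  ultimately show ?thesis
    by simp
qed

text \<open>
  Consider the sets \<open>B\<close> for which \<open>K\<close> contains every vector supported on \<open>B\<close>. They include the
  support of each \<open>u \<in> K\<close>: where \<open>v\<close> is at most \<open>k\<close> times as large as \<open>u \<noteq> 0\<close>, it is a bounded multiple
  of \<open>u\<close>, and these regions exhaust the support. They are closed under finite and increasing
  unions, so by finiteness of the measure one of them has maximal measure, and up to null sets it
  contains the supports of all vectors in \<open>K\<close>.
\<close>

lemma masa_invariant_subspace:
  assumes fin: "finite_measure m" and K: "closed_subspace m K"
    and inv: "\<And>\<phi> u. ess_bounded m \<phi> \<Longrightarrow> u \<in> K \<Longrightarrow> mult_op m \<phi> u \<in> K"
  obtains \<beta> where "\<beta> \<in> sets m" "K = char_proj m \<beta> ` L2 m"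
proof -
  interpret finite_measure m by (rule fin)
  have K_sub: "u \<in> L2 m" if "u \<in> K" for u
    using closed_subspace_subset[OF K] that by blast
  \<comment> \<open>\<open>indicator B * g\<close> with \<open>g \<in> L2 m\<close> is the general vector supported on \<open>B\<close>\<close>
  define \<S> where "\<S> = {B \<in> sets m. \<forall>g\<in>L2 m. mult_op m (indicator B) g \<in> K}"
  have \<S>_sets: "B \<in> sets m" if "B \<in> \<S>" for B
    using that by (simp add: \<S>_def)
  have \<S>_Union: "(\<Union>k. A k) \<in> \<S>" if A: "\<And>k. A k \<in> \<S>" "incseq A" for A :: "nat \<Rightarrow> _"
  proof -
    have "mult_op m (indicator (\<Union>k. A k)) g \<in> K" if g: "g \<in> L2 m" for g
    proof (rule closed_subspace_limit[OF K])
      show "mult_op m (indicator (A k)) g \<in> K" for k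
        using A(1)[of k] g by (simp add: \<S>_def)
      show "mult_op m (indicator (\<Union>k. A k)) g \<in> L2 m"
        using A(1) \<S>_sets by (intro mult_op_in_L2[OF _ g] ess_bounded_indicator sets.countable_UN) blast
      show "(\<lambda>k. l2_dist m (mult_op m (indicator (A k)) g) (mult_op m (indicator (\<Union>k. A k)) g)) \<longlonglongrightarrow> 0"
        using mult_op_indicator_limit[OF g] A \<S>_sets by blast
    qed
    moreover have "(\<Union>k. A k) \<in> sets m"
      using A(1) \<S>_sets by (intro sets.countable_UN) blast
    ultimately show ?thesis
      unfolding \<S>_def by blast
  qed
  have \<S>_Un: "A \<union> B \<in> \<S>" if A: "A \<in> \<S>" and B: "B \<in> \<S>" for A B
  proof -
    have s: "A \<in> sets m" "B - A \<in> sets m" "A \<union> B \<in> sets m" "B \<in> sets m"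
      using A B \<S>_sets by auto
    have "mult_op m (indicator (A \<union> B)) g \<in> K" if g: "g \<in> L2 m" for g
    proof -
      have "mult_op m (indicator (A \<union> B)) g
          = l2_add m (mult_op m (indicator A) g) (mult_op m (indicator B) (mult_op m (indicator (B - A)) g))"
      proof (rule L2_eqI[of _ m])
        show "AE x in m. l2_rep (mult_op m (indicator (A \<union> B)) g) x = l2_rep (l2_add m (mult_op m (indicator A) g)
            (mult_op m (indicator B) (mult_op m (indicator (B - A)) g))) x"
          using AE_rep_mult_op[OF ess_bounded_indicator[OF s(3)] g]
            AE_rep_mult_op[OF ess_bounded_indicator[OF s(1)] g]
            AE_rep_mult_op[OF ess_bounded_indicator[OF s(2)] g]
            AE_rep_mult_op[OF ess_bounded_indicator[OF s(4)] mult_op_in_L2[OF ess_bounded_indicator[OF s(2)] g]]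
            AE_rep_add[OF mult_op_in_L2[OF ess_bounded_indicator[OF s(1)] g]
              mult_op_in_L2[OF ess_bounded_indicator[OF s(4)] mult_op_in_L2[OF ess_bounded_indicator[OF s(2)] g]]]
        proof eventually_elim
          case (elim x)
          then show ?case
            by (simp only: elim) (auto split: split_indicator)
        qed
      qed (use g s in \<open>auto simp: ess_bounded_indicator\<close>)
      also have "\<dots> \<in> K"
        using A B g s by (intro closed_subspace_add[OF K]) (auto simp: \<S>_def ess_bounded_indicator)
      finally show ?thesis .
    qed
    then show ?thesis
      using s by (simp add: \<S>_def)
  qed
  have \<S>_support: "{x \<in> space m. l2_rep u x \<noteq> 0} \<in> \<S>" if u: "u \<in> K" for u
  proof -
    let ?f = "l2_rep u"
    have f [measurable]: "?f \<in> borel_measurable m"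
      using u K_sub by simp
    have "mult_op m (indicator {x \<in> space m. ?f x \<noteq> 0}) v \<in> K" if v: "v \<in> L2 m" for v
    proof -
      let ?g = "l2_rep v"
      have g [measurable]: "?g \<in> borel_measurable m"
        using v by simp
      define A where "A k = {x \<in> space m. ?f x \<noteq> 0 \<and> cmod (?g x) \<le> real k * cmod (?f x)}" for k
      have [measurable]: "A k \<in> sets m" for k
        unfolding A_def by measurable
      have "incseq A"
        unfolding incseq_def A_def
        by (auto intro: order_trans mult_right_mono)
      have Un: "(\<Union>k. A k) = {x \<in> space m. ?f x \<noteq> 0}"
      proof -
        have "\<exists>k. cmod (?g x) \<le> real k * cmod (?f x)" if "?f x \<noteq> 0" for x
        proof -
          obtain k where "cmod (?g x) / cmod (?f x) \<le> real k"
            using real_arch_simple by blast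
          then show ?thesis
            using that by (auto simp: field_simps)
        qed
        then show ?thesis
          by (auto simp: A_def)
      qed
      have "mult_op m (indicator (A k)) v \<in> K" for k
      proof -
        \<comment> \<open>the bounded multiplier that carries \<open>u\<close> to the part of \<open>v\<close> on \<open>A k\<close>\<close>
        define \<phi> where "\<phi> x = indicator (A k) x * (?g x / ?f x)" for x
        have \<phi>: "ess_bounded m \<phi>"
        proof -
          have "cmod (\<phi> x) \<le> real k" for x
            by (auto simp: \<phi>_def A_def norm_divide field_simps split: split_indicator)
          moreover have "\<phi> \<in> borel_measurable m"
            unfolding \<phi>_def by measurable
          ultimately show ?thesis
            by (auto simp: ess_bounded_def)
        qed
        have "mult_op m (indicator (A k)) v = mult_op m \<phi> u"
        proof (rule L2_eqI[of _ m])
          show "AE x in m. l2_rep (mult_op m (indicator (A k)) v) x = l2_rep (mult_op m \<phi> u) x"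
            using AE_rep_mult_op[OF \<phi> K_sub[OF u]] AE_rep_mult_op[OF ess_bounded_indicator v, of "A k"]
            by (auto simp: \<phi>_def A_def split: split_indicator)
        qed (use u v \<phi> K_sub in \<open>auto simp: ess_bounded_indicator\<close>)
        then show ?thesis
          using inv[OF \<phi> u] by simp
      qed
      then have "mult_op m (indicator (\<Union>k. A k)) v \<in> K"
        using v by (intro closed_subspace_limit[OF K _ _ mult_op_indicator_limit[OF v _ \<open>incseq A\<close>]])
          (auto simp: ess_bounded_indicator)
      then show ?thesis
        by (simp add: Un)
    qed
    then show ?thesis
      by (simp add: \<S>_def)
  qed
  have "mult_op m (indicator {}) = mult_op m (\<lambda>x. 0)"
    by (rule arg_cong[where f = "mult_op m"]) auto
  then have "{} \<in> \<S>"
    using closed_subspace_zero[OF K] by (simp add: \<S>_def mult_op_const_zero)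
  define s where "s = (SUP B\<in>\<S>. measure m B)"
  have bdd: "bdd_above (measure m ` \<S>)"
    by (rule bdd_aboveI[of _ "measure m (space m)"]) (auto intro: bounded_measure)
  have le_s: "measure m B \<le> s" if "B \<in> \<S>" for B
    unfolding s_def by (rule cSUP_upper[OF that bdd])
  have "\<exists>B\<in>\<S>. s - 1 / real (Suc k) < measure m B" for k
    using less_cSUP_iff[of \<S> "measure m" "s - 1 / real (Suc k)"] \<open>{} \<in> \<S>\<close> bdd
    by (auto simp: s_def[symmetric])
  then obtain B where B: "\<And>k. B k \<in> \<S>" "\<And>k. s - 1 / real (Suc k) < measure m (B k)"
    by metis
  define A where "A k = (\<Union>i\<le>k. B i)" for k :: nat
  have A: "A k \<in> \<S>" for k
  proof (induction k)
    case 0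
    then show ?case using B by (simp add: A_def)
  next
    case (Suc k)
    then show ?case using B \<S>_Un[of "B (Suc k)" "A k"] by (simp add: A_def atMost_Suc)
  qed
  define \<beta> where "\<beta> = (\<Union>k. A k)"
  have \<beta>: "\<beta> \<in> \<S>"
    unfolding \<beta>_def by (rule \<S>_Union[OF A]) (fastforce simp: incseq_def A_def)
  have "s \<le> measure m \<beta>"
  proof (rule field_le_epsilon)
    fix e :: real assume "e > 0"
    then obtain k where k: "1 / real (Suc k) < e"
      using nat_approx_posE by blast
    have "B k \<subseteq> \<beta>"
      unfolding \<beta>_def A_def by blast
    then have "measure m (B k) \<le> measure m \<beta>"
      by (rule finite_measure_mono) (rule \<S>_sets[OF \<beta>])
    then show "s \<le> measure m \<beta> + e"
      using B(2)[of k] k by linarith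
  qed
  have "u \<in> char_proj m \<beta> ` L2 m" if u: "u \<in> K" for u
  proof -
    define D where "D = {x \<in> space m. l2_rep u x \<noteq> 0}"
    have D: "D \<in> \<S>"
      unfolding D_def by (rule \<S>_support[OF u])
    have "measure m (\<beta> \<union> D) = measure m \<beta> + measure m (D - \<beta>)"
      using \<S>_sets[OF \<beta>] \<S>_sets[OF D] finite_measure_Union[of \<beta> "D - \<beta>"] by (simp add: Un_Diff_cancel)
    then have "measure m (D - \<beta>) = 0"
      using le_s[OF \<S>_Un[OF \<beta> D]] \<open>s \<le> measure m \<beta>\<close> measure_nonneg[of m "D - \<beta>"] by linarith
    then have "D - \<beta> \<in> null_sets m"
      using \<S>_sets[OF \<beta>] \<S>_sets[OF D] by (auto simp: emeasure_eq_measure intro!: null_setsI)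
    then have "AE x in m. x \<notin> D - \<beta>"
      by (rule AE_not_in)
    then have "AE x in m. l2_rep u x = l2_rep (mult_op m (indicator \<beta>) u) x"
      using AE_rep_mult_op[OF ess_bounded_indicator[OF \<S>_sets[OF \<beta>]] K_sub[OF u]] AE_space
      by eventually_elim (auto simp: D_def split: split_indicator)
    then have "u = mult_op m (indicator \<beta>) u"
      using K_sub[OF u] \<S>_sets[OF \<beta>] by (intro L2_eqI) (auto simp: ess_bounded_indicator)
    then show ?thesis
      using K_sub[OF u] unfolding char_proj_def by (rule image_eqI)
  qed
  moreover have "char_proj m \<beta> ` L2 m \<subseteq> K"
    using \<beta> by (auto simp: char_proj_def \<S>_def)
  ultimately have "K = char_proj m \<beta> ` L2 m"
    by blast
  then show thesis
    using that \<S>_sets[OF \<beta>] by blast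
qed

section \<open>Compressions of operators and masa-bimodules\<close>

definition sandwich ::
  "'a measure \<Rightarrow> 'b measure \<Rightarrow> ('a \<Rightarrow> complex) \<Rightarrow> ('b \<Rightarrow> complex) \<Rightarrow> ('a, 'b) l2_op \<Rightarrow> ('a, 'b) l2_op" where
  "sandwich m n \<phi> \<psi> T = compose (L2 m) (mult_op n \<psi>) (compose (L2 m) T (mult_op m \<phi>))"

definition block ::
  "'a measure \<Rightarrow> 'b measure \<Rightarrow> 'a set \<Rightarrow> 'b set \<Rightarrow> ('a, 'b) l2_op \<Rightarrow> ('a, 'b) l2_op" where
  "block m n \<alpha> \<beta> = sandwich m n (indicator \<alpha>) (indicator \<beta>)"

lemma sandwich_apply: "u \<in> L2 m \<Longrightarrow> sandwich m n \<phi> \<psi> T u = mult_op n \<psi> (T (mult_op m \<phi> u))"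
  by (simp add: sandwich_def compose_eq)

lemma block_apply:
  "u \<in> L2 m \<Longrightarrow> block m n \<alpha> \<beta> T u = mult_op n (indicator \<beta>) (T (mult_op m (indicator \<alpha>) u))"
  by (simp add: block_def sandwich_apply)

lemma op_zero_apply: "u \<in> L2 m \<Longrightarrow> op_zero m n u = l2_zero n"
  by (simp add: op_zero_def)

lemma op_add_apply: "u \<in> L2 m \<Longrightarrow> op_add m n S T u = l2_add n (S u) (T u)"
  by (simp add: op_add_def)

lemma op_scale_apply: "u \<in> L2 m \<Longrightarrow> op_scale m n c T u = l2_scale n c (T u)"
  by (simp add: op_scale_def)

lemma op_add_commute: "op_add m n S T = op_add m n T S"
  by (simp add: op_add_def l2_add_commute)

lemma op_add_zero:
  assumes "T \<in> bounded_ops m n"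
  shows "op_add m n T (op_zero m n) = T"
  by (rule bounded_ops_eqI[OF op_add_bounded[OF assms op_zero_bounded] assms])
    (simp add: op_add_apply op_zero_apply bounded_ops_in_L2[OF assms])

lemma op_add_swap:
  assumes "S \<in> bounded_ops m n" "T \<in> bounded_ops m n" "S' \<in> bounded_ops m n" "T' \<in> bounded_ops m n"
  shows "op_add m n (op_add m n S T) (op_add m n S' T') = op_add m n (op_add m n S S') (op_add m n T T')"
  by (rule bounded_ops_eqI[of _ m n])
    (simp_all add: op_add_bounded assms op_add_apply l2_add_swap bounded_ops_in_L2[OF assms(1)]
      bounded_ops_in_L2[OF assms(2)] bounded_ops_in_L2[OF assms(3)] bounded_ops_in_L2[OF assms(4)])

lemma sandwich_bounded:
  assumes "ess_bounded m \<phi>" "ess_bounded n \<psi>" "T \<in> bounded_ops m n"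
  shows "sandwich m n \<phi> \<psi> T \<in> bounded_ops m n"
  unfolding sandwich_def
  by (rule compose_bounded[OF mult_op_bounded[OF assms(2)] compose_bounded[OF assms(3) mult_op_bounded[OF assms(1)]]])

lemma sandwich_sandwich:
  assumes "ess_bounded m \<phi>" "ess_bounded n \<psi>" "ess_bounded m \<phi>'" "ess_bounded n \<psi>'" "T \<in> bounded_ops m n"
  shows "sandwich m n \<phi> \<psi> (sandwich m n \<phi>' \<psi>' T) = sandwich m n (\<lambda>x. \<phi> x * \<phi>' x) (\<lambda>y. \<psi> y * \<psi>' y) T"
proof (rule bounded_ops_eqI[of _ m n])
  show "sandwich m n \<phi> \<psi> (sandwich m n \<phi>' \<psi>' T) u = sandwich m n (\<lambda>x. \<phi> x * \<phi>' x) (\<lambda>y. \<psi> y * \<psi>' y) T u"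
    if u: "u \<in> L2 m" for u
    by (simp add: sandwich_apply assms u mult_op_mult_op ess_bounded_mult bounded_ops_in_L2[OF assms(5)] mult.commute)
qed (intro sandwich_bounded ess_bounded_mult assms)+

lemma sandwich_add:
  assumes "ess_bounded m \<phi>" "ess_bounded n \<psi>" "S \<in> bounded_ops m n" "T \<in> bounded_ops m n"
  shows "sandwich m n \<phi> \<psi> (op_add m n S T) = op_add m n (sandwich m n \<phi> \<psi> S) (sandwich m n \<phi> \<psi> T)"
  by (rule bounded_ops_eqI[of _ m n])
    (simp_all add: sandwich_bounded op_add_bounded assms sandwich_apply op_add_apply mult_op_add
      bounded_ops_in_L2[OF assms(3)] bounded_ops_in_L2[OF assms(4)])

lemma sandwich_scale:
  assumes "ess_bounded m \<phi>" "ess_bounded n \<psi>" "T \<in> bounded_ops m n"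
  shows "sandwich m n \<phi> \<psi> (op_scale m n c T) = op_scale m n c (sandwich m n \<phi> \<psi> T)"
  by (rule bounded_ops_eqI[of _ m n])
    (simp_all add: sandwich_bounded op_scale_bounded assms sandwich_apply op_scale_apply mult_op_scale
      bounded_ops_in_L2[OF assms(3)])

lemma sandwich_zero:
  assumes "ess_bounded m \<phi>" "ess_bounded n \<psi>"
  shows "sandwich m n \<phi> \<psi> (op_zero m n) = op_zero m n"
  by (rule bounded_ops_eqI[of _ m n])
    (simp_all add: sandwich_bounded op_zero_bounded assms sandwich_apply op_zero_apply mult_op_zero)

lemma op_scale_eq_sandwich:
  assumes "T \<in> bounded_ops m n"
  shows "op_scale m n c T = sandwich m n (\<lambda>x. 1) (\<lambda>y. c) T"
  by (rule bounded_ops_eqI[of _ m n])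
    (simp_all add: sandwich_bounded op_scale_bounded assms sandwich_apply op_scale_apply ess_bounded_const
      mult_op_one l2_scale_eq_mult_op bounded_ops_in_L2[OF assms])

lemma op_scale_zero: "op_scale m n c (op_zero m n) = op_zero m n"
  by (simp add: op_scale_eq_sandwich op_zero_bounded sandwich_zero ess_bounded_const)

lemma block_bounded:
  "\<alpha> \<in> sets m \<Longrightarrow> \<beta> \<in> sets n \<Longrightarrow> T \<in> bounded_ops m n \<Longrightarrow> block m n \<alpha> \<beta> T \<in> bounded_ops m n"
  by (simp add: block_def sandwich_bounded ess_bounded_indicator)

lemma block_block:
  assumes "\<alpha> \<in> sets m" "\<beta> \<in> sets n" "\<alpha>' \<in> sets m" "\<beta>' \<in> sets n" "T \<in> bounded_ops m n"
  shows "block m n \<alpha> \<beta> (block m n \<alpha>' \<beta>' T) = block m n (\<alpha> \<inter> \<alpha>') (\<beta> \<inter> \<beta>') T"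
  using assms by (simp add: block_def sandwich_sandwich ess_bounded_indicator indicator_inter_arith[symmetric])

lemma block_sandwich_commute:
  assumes "\<alpha> \<in> sets m" "\<beta> \<in> sets n" "ess_bounded m \<phi>" "ess_bounded n \<psi>" "T \<in> bounded_ops m n"
  shows "block m n \<alpha> \<beta> (sandwich m n \<phi> \<psi> T) = sandwich m n \<phi> \<psi> (block m n \<alpha> \<beta> T)"
  using assms by (simp add: block_def sandwich_sandwich ess_bounded_indicator mult.commute)

lemma block_add:
  assumes "\<alpha> \<in> sets m" "\<beta> \<in> sets n" "S \<in> bounded_ops m n" "T \<in> bounded_ops m n"
  shows "block m n \<alpha> \<beta> (op_add m n S T) = op_add m n (block m n \<alpha> \<beta> S) (block m n \<alpha> \<beta> T)"
  using assms by (simp add: block_def sandwich_add ess_bounded_indicator)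

lemma block_scale:
  assumes "\<alpha> \<in> sets m" "\<beta> \<in> sets n" "T \<in> bounded_ops m n"
  shows "block m n \<alpha> \<beta> (op_scale m n c T) = op_scale m n c (block m n \<alpha> \<beta> T)"
  using assms by (simp add: block_def sandwich_scale ess_bounded_indicator)

lemma block_zero:
  assumes "\<alpha> \<in> sets m" "\<beta> \<in> sets n"
  shows "block m n \<alpha> \<beta> (op_zero m n) = op_zero m n"
  using assms by (simp add: block_def sandwich_zero ess_bounded_indicator)

definition bimodule :: "'a measure \<Rightarrow> 'b measure \<Rightarrow> ('a, 'b) l2_op set \<Rightarrow> bool" where
  "bimodule m n U \<longleftrightarrow> op_subspace m n U \<and> masa_bimodule m n U"

lemma bimodule_iff:
  "bimodule m n U \<longleftrightarrow> op_subspace m n U \<and>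
    (\<forall>T\<in>U. \<forall>\<phi> \<psi>. ess_bounded m \<phi> \<longrightarrow> ess_bounded n \<psi> \<longrightarrow> sandwich m n \<phi> \<psi> T \<in> U)"
  unfolding bimodule_def masa_bimodule_def mult_masa_altdef sandwich_def by blast

lemma bimoduleD:
  assumes "bimodule m n U"
  shows bimodule_bounded: "T \<in> U \<Longrightarrow> T \<in> bounded_ops m n"
    and bimodule_zero: "op_zero m n \<in> U"
    and bimodule_add: "S \<in> U \<Longrightarrow> T \<in> U \<Longrightarrow> op_add m n S T \<in> U"
    and bimodule_scale: "T \<in> U \<Longrightarrow> op_scale m n c T \<in> U"
    and bimodule_sandwich: "T \<in> U \<Longrightarrow> ess_bounded m \<phi> \<Longrightarrow> ess_bounded n \<psi> \<Longrightarrow> sandwich m n \<phi> \<psi> T \<in> U"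
  using assms unfolding bimodule_iff op_subspace_def by blast+

text \<open>
  Scalar multiplication is a sandwich between constant functions, hence comes for free.
\<close>

lemma bimoduleI:
  assumes "\<And>T. T \<in> U \<Longrightarrow> T \<in> bounded_ops m n"
    and "op_zero m n \<in> U"
    and "\<And>S T. S \<in> U \<Longrightarrow> T \<in> U \<Longrightarrow> op_add m n S T \<in> U"
    and "\<And>T \<phi> \<psi>. T \<in> U \<Longrightarrow> ess_bounded m \<phi> \<Longrightarrow> ess_bounded n \<psi> \<Longrightarrow> sandwich m n \<phi> \<psi> T \<in> U"
  shows "bimodule m n U"
proof -
  have "op_scale m n c T \<in> U" if "T \<in> U" for c T
    using assms(4)[OF that ess_bounded_const ess_bounded_const] op_scale_eq_sandwich[OF assms(1)[OF that]]
    by simp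
  then show ?thesis
    unfolding bimodule_iff op_subspace_def using assms by blast
qed

lemma bimodule_block:
  "bimodule m n U \<Longrightarrow> T \<in> U \<Longrightarrow> \<alpha> \<in> sets m \<Longrightarrow> \<beta> \<in> sets n \<Longrightarrow> block m n \<alpha> \<beta> T \<in> U"
  by (simp add: block_def bimodule_sandwich ess_bounded_indicator)

definition vanishes_on ::
  "'a measure \<Rightarrow> 'b measure \<Rightarrow> ('a, 'b) l2_op set \<Rightarrow> 'a set \<Rightarrow> 'b set \<Rightarrow> bool" where
  "vanishes_on m n U \<alpha> \<beta> \<longleftrightarrow> (\<forall>T\<in>U. block m n \<alpha> \<beta> T = op_zero m n)"

lemma vanishes_on_mono: "vanishes_on m n U \<alpha> \<beta> \<Longrightarrow> V \<subseteq> U \<Longrightarrow> vanishes_on m n V \<alpha> \<beta>"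
  by (auto simp: vanishes_on_def)


section \<open>The map of a bimodule\<close>

lemma char_proj_in_projections:
  assumes "\<beta> \<in> sets m"
  shows "char_proj m \<beta> \<in> projections m"
proof -
  note b = ess_bounded_indicator[OF assms]
  have idem: "char_proj m \<beta> (char_proj m \<beta> u) = char_proj m \<beta> u" if "u \<in> L2 m" for u
    using that by (simp add: char_proj_def mult_op_mult_op b indicator_inter_arith[symmetric])
  have bd: "char_proj m \<beta> \<in> bounded_ops m m"
    by (simp add: char_proj_def mult_op_bounded b)
  have "compose (L2 m) (char_proj m \<beta>) (char_proj m \<beta>) = char_proj m \<beta>"
    by (rule bounded_ops_eqI[OF compose_bounded[OF bd bd] bd]) (simp add: compose_eq idem)
  moreover have "(\<lambda>x. cnj (indicator \<beta> x)) = indicator \<beta>"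
    by (auto split: split_indicator)
  then have "l2_inner m (char_proj m \<beta> u) v = l2_inner m u (char_proj m \<beta> v)"
    if "u \<in> L2 m" "v \<in> L2 m" for u v
    using l2_inner_mult_op[OF b that] by (simp add: char_proj_def)
  ultimately show ?thesis
    using bd by (simp add: projections_def)
qed

lemma char_proj_range_iff:
  assumes "\<beta> \<in> sets m" "u \<in> L2 m"
  shows "u \<in> char_proj m \<beta> ` L2 m \<longleftrightarrow> char_proj m \<beta> u = u"
    and "u \<in> char_proj m \<beta> ` L2 m \<longleftrightarrow> mult_op m (indicator (space m - \<beta>)) u = l2_zero m"
proof -
  note b = ess_bounded_indicator[OF assms(1)]
  have c: "ess_bounded m (indicator (space m - \<beta>))"
    using assms by (intro ess_bounded_indicator) auto
  show 1: "u \<in> char_proj m \<beta> ` L2 m \<longleftrightarrow> char_proj m \<beta> u = u"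
  proof
    assume "u \<in> char_proj m \<beta> ` L2 m"
    then show "char_proj m \<beta> u = u"
      by (auto simp: char_proj_def mult_op_mult_op b indicator_inter_arith[symmetric])
  next
    assume "char_proj m \<beta> u = u"
    then show "u \<in> char_proj m \<beta> ` L2 m"
      using assms(2) by (metis imageI)
  qed
  have "char_proj m \<beta> u = u \<longleftrightarrow> mult_op m (indicator (space m - \<beta>)) u = l2_zero m"
  proof
    assume eq: "char_proj m \<beta> u = u"
    have "mult_op m (indicator (space m - \<beta>)) (char_proj m \<beta> u) = mult_op m (\<lambda>x. 0) u"
    proof -
      have "(\<lambda>x. indicator (space m - \<beta>) x * indicator \<beta> x) = (\<lambda>x. 0 :: complex)"
        by (auto split: split_indicator)
      then show ?thesis
        using assms by (simp add: char_proj_def mult_op_mult_op b c)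
    qed
    then show "mult_op m (indicator (space m - \<beta>)) u = l2_zero m"
      using eq assms by (simp add: mult_op_const_zero)
  next
    assume eq: "mult_op m (indicator (space m - \<beta>)) u = l2_zero m"
    have "AE x in m. l2_rep (mult_op m (indicator (space m - \<beta>)) u) x = 0"
      unfolding eq by (rule AE_rep_zero)
    then have "AE x in m. l2_rep (char_proj m \<beta> u) x = l2_rep u x"
      unfolding char_proj_def
      using AE_rep_mult_op[OF b assms(2)] AE_rep_mult_op[OF c assms(2)] AE_space
      by eventually_elim (auto split: split_indicator_asm)
    then show "char_proj m \<beta> u = u"
      using assms b by (intro L2_eqI[of _ m]) (auto simp: char_proj_def)
  qed
  with 1 show "u \<in> char_proj m \<beta> ` L2 m \<longleftrightarrow> mult_op m (indicator (space m - \<beta>)) u = l2_zero m"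
    by simp
qed

lemma projection_fixes_range:
  assumes "P \<in> projections m" "u \<in> P ` L2 m"
  shows "P u = u"
proof -
  obtain v where v: "v \<in> L2 m" "u = P v"
    using assms(2) by auto
  have "compose (L2 m) P P v = P v"
    using assms(1) by (simp add: projections_def)
  then show ?thesis
    using v by (simp add: compose_eq)
qed

text \<open>
  If \<open>P\<close> and \<open>Q\<close> have the same range, then \<open>QP = P\<close> and \<open>PQ = Q\<close>; taking adjoints in the first
  equation gives \<open>P = PQ = Q\<close>.
\<close>

lemma projection_eqI:
  assumes P: "P \<in> projections m" and Q: "Q \<in> projections m" and range: "P ` L2 m = Q ` L2 m"
  shows "P = Q"
proof -
  have bd: "P \<in> bounded_ops m m" "Q \<in> bounded_ops m m"
    using P Q by (auto simp: projections_def)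
  note in_L2 = bounded_ops_in_L2[OF bd(1)] bounded_ops_in_L2[OF bd(2)]
  have sa: "l2_inner m (P u) v = l2_inner m u (P v)" "l2_inner m (Q u) v = l2_inner m u (Q v)"
    if "u \<in> L2 m" "v \<in> L2 m" for u v
    using P Q that by (auto simp: projections_def)
  have QP: "Q (P u) = P u" and PQ: "P (Q u) = Q u" if "u \<in> L2 m" for u
    using projection_fixes_range[OF Q, of "P u"] projection_fixes_range[OF P, of "Q u"] that range
    by blast+
  show ?thesis
  proof (rule bounded_ops_eqI[OF bd])
    fix u assume u: "u \<in> L2 m"
    show "P u = Q u"
    proof (rule L2_eqI_inner)
      fix w assume w: "w \<in> L2 m"
      have "l2_inner m (P u) w = l2_inner m (Q (P u)) w"
        using QP u by simp
      also have "\<dots> = l2_inner m u (P (Q w))"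
        using sa u w in_L2 by simp
      also have "\<dots> = l2_inner m (Q u) w"
        using PQ sa u w by simp
      finally show "l2_inner m (P u) w = l2_inner m (Q u) w" .
    qed (use in_L2 u in auto)
  qed
qed

definition image_span ::
  "'a measure \<Rightarrow> 'b measure \<Rightarrow> ('a, 'b) l2_op set \<Rightarrow> ('a, 'a) l2_op \<Rightarrow> ('b \<Rightarrow> complex) set set" where
  "image_span m n U P = l2_closed_span n {S u | S u. S \<in> U \<and> u \<in> P ` L2 m}"

lemma projection_range_subset: "P \<in> projections m \<Longrightarrow> u \<in> P ` L2 m \<Longrightarrow> u \<in> L2 m"
  using bounded_ops_in_L2 by (auto simp: projections_def)

lemma image_span_superset: "S \<in> U \<Longrightarrow> u \<in> P ` L2 m \<Longrightarrow> S u \<in> image_span m n U P"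
  unfolding image_span_def by (rule subsetD[OF l2_closed_span_superset]) blast

lemma image_span_minimal:
  assumes "closed_subspace n V" "\<And>S u. S \<in> U \<Longrightarrow> u \<in> P ` L2 m \<Longrightarrow> S u \<in> V"
  shows "image_span m n U P \<subseteq> V"
  unfolding image_span_def by (rule l2_closed_span_minimal[OF assms(1)]) (use assms(2) in blast)

lemma closed_subspace_image_span:
  assumes U: "bimodule m n U" and P: "P \<in> projections m"
  shows "closed_subspace n (image_span m n U P)"
  unfolding image_span_def
proof (rule closed_subspace_l2_closed_span)
  have "S u \<in> L2 n" if "S \<in> U" "u \<in> P ` L2 m" for S u
    using bounded_ops_in_L2[OF bimodule_bounded[OF U that(1)] projection_range_subset[OF P that(2)]] .
  then show "{S u |S u. S \<in> U \<and> u \<in> P ` L2 m} \<subseteq> L2 n"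
    by blast
qed

text \<open>
  The bimodule property on the left makes the closed span invariant under the masa of the range
  space.
\<close>

lemma image_span_eq_char_proj_range:
  assumes n: "finite_measure n" and U: "bimodule m n U" and P: "P \<in> projections m"
  obtains \<beta> where "\<beta> \<in> sets n" "image_span m n U P = char_proj n \<beta> ` L2 n"
proof (rule masa_invariant_subspace[OF n closed_subspace_image_span[OF U P]])
  let ?K = "image_span m n U P"
  fix \<psi> w assume \<psi>: "ess_bounded n \<psi>" and w: "w \<in> ?K"
  have "?K \<subseteq> {w \<in> L2 n. mult_op n \<psi> w \<in> ?K}"
  proof (rule image_span_minimal)
    show "closed_subspace n {w \<in> L2 n. mult_op n \<psi> w \<in> ?K}"
      by (rule closed_subspace_vimage[OF mult_op_bounded[OF \<psi>] closed_subspace_image_span[OF U P]])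
    fix S u assume S: "S \<in> U" and u: "u \<in> P ` L2 m"
    have uL: "u \<in> L2 m"
      by (rule projection_range_subset[OF P u])
    have "sandwich m n (\<lambda>x. 1) \<psi> S \<in> U"
      by (rule bimodule_sandwich[OF U S ess_bounded_const \<psi>])
    then have "sandwich m n (\<lambda>x. 1) \<psi> S u \<in> ?K"
      using u by (rule image_span_superset)
    then show "S u \<in> {w \<in> L2 n. mult_op n \<psi> w \<in> ?K}"
      using uL bounded_ops_in_L2[OF bimodule_bounded[OF U S] uL] by (simp add: sandwich_apply mult_op_one)
  qed
  then show "mult_op n \<psi> w \<in> ?K"
    using w by blast
qed (rule that)

text \<open>
  The definite description in the definition of the map denotes: the characteristic projection
  onto the closed span exists, and a projection is determined by its range.
\<close>

lemma op_Map_range: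
  assumes "finite_measure n" "bimodule m n U" "P \<in> projections m"
  shows "op_Map m n U P \<in> projections n" "op_Map m n U P ` L2 n = image_span m n U P"
proof -
  obtain \<beta> where \<beta>: "\<beta> \<in> sets n" "image_span m n U P = char_proj n \<beta> ` L2 n"
    using image_span_eq_char_proj_range[OF assms] .
  have "op_Map m n U P = char_proj n \<beta>"
    using assms(3) unfolding op_Map_def image_span_def[symmetric]
    by (simp, intro the_equality)
      (auto simp: \<beta> char_proj_in_projections intro: projection_eqI)
  then show "op_Map m n U P \<in> projections n" "op_Map m n U P ` L2 n = image_span m n U P"
    using \<beta> char_proj_in_projections by auto
qed

text \<open>
  The range of an arbitrary projection \<open>P\<close> is replaced by the range of a characteristic projection.
  Let \<open>P(\<gamma>)\<close> be the projection onto the closed span \<open>[U P]\<close> and \<open>\<beta>\<close> the complement of \<open>\<gamma>\<close>. The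
  vectors that \<open>U\<close> maps into \<open>[U P]\<close> form a closed masa-invariant subspace, hence the range of some
  \<open>P(\<alpha>)\<close>, and it contains the range of \<open>P\<close>. Now \<open>U\<close> vanishes on \<open>\<alpha> \<times> \<beta>\<close>, so \<open>V\<close> does, and \<open>V\<close> maps the
  range of \<open>P\<close> into \<open>[U P]\<close>.
\<close>

lemma vanishes_on_imp_image_span_subset:
  assumes m: "finite_measure m" and n: "finite_measure n"
    and U: "bimodule m n U" and V: "bimodule m n V"
    and van: "\<And>\<alpha> \<beta>. \<alpha> \<in> sets m \<Longrightarrow> \<beta> \<in> sets n \<Longrightarrow> vanishes_on m n U \<alpha> \<beta> \<Longrightarrow> vanishes_on m n V \<alpha> \<beta>"
    and P: "P \<in> projections m"
  shows "image_span m n V P \<subseteq> image_span m n U P"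
proof -
  obtain \<gamma> where \<gamma>: "\<gamma> \<in> sets n" "image_span m n U P = char_proj n \<gamma> ` L2 n"
    using image_span_eq_char_proj_range[OF n U P] .
  define \<beta> where "\<beta> = space n - \<gamma>"
  have \<beta>: "\<beta> \<in> sets n"
    using \<gamma> by (simp add: \<beta>_def)
  note b = ess_bounded_indicator[OF \<beta>]
  have in_K: "w \<in> image_span m n U P \<longleftrightarrow> mult_op n (indicator \<beta>) w = l2_zero n" if "w \<in> L2 n" for w
    using char_proj_range_iff(2)[OF \<gamma>(1) that] by (simp add: \<gamma>(2) \<beta>_def)
  define K where "K = (\<Inter>S\<in>U. {u \<in> L2 m. compose (L2 m) (mult_op n (indicator \<beta>)) S u = l2_zero n})"
  have K_iff: "u \<in> K \<longleftrightarrow> u \<in> L2 m \<and> (\<forall>S\<in>U. mult_op n (indicator \<beta>) (S u) = l2_zero n)" for u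
    using bimodule_zero[OF U] by (auto simp: K_def compose_eq)
  have "closed_subspace m K"
    unfolding K_def
  proof (rule closed_subspace_Inter)
    show "(\<lambda>S. {u \<in> L2 m. compose (L2 m) (mult_op n (indicator \<beta>)) S u = l2_zero n}) ` U \<noteq> {}"
      using bimodule_zero[OF U] by blast
    fix W assume "W \<in> (\<lambda>S. {u \<in> L2 m. compose (L2 m) (mult_op n (indicator \<beta>)) S u = l2_zero n}) ` U"
    then obtain S where "S \<in> U" "W = {u \<in> L2 m. compose (L2 m) (mult_op n (indicator \<beta>)) S u = l2_zero n}"
      by blast
    then show "closed_subspace m W"
      using closed_subspace_kernel[OF compose_bounded[OF mult_op_bounded[OF b] bimodule_bounded[OF U]]]
      by simp
  qed
  moreover have "mult_op m \<phi> u \<in> K" if \<phi>: "ess_bounded m \<phi>" and u: "u \<in> K" for \<phi> u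
  proof -
    have uL: "u \<in> L2 m"
      using u K_iff by blast
    have "mult_op n (indicator \<beta>) (S (mult_op m \<phi> u)) = l2_zero n" if S: "S \<in> U" for S
    proof -
      have "sandwich m n \<phi> (\<lambda>x. 1) S \<in> U"
        by (rule bimodule_sandwich[OF U S \<phi> ess_bounded_const])
      then have "mult_op n (indicator \<beta>) (sandwich m n \<phi> (\<lambda>x. 1) S u) = l2_zero n"
        using u K_iff by blast
      then show ?thesis
        using uL \<phi> bounded_ops_in_L2[OF bimodule_bounded[OF U S]] by (simp add: sandwich_apply mult_op_one)
    qed
    then show ?thesis
      using uL \<phi> by (simp add: K_iff)
  qed
  ultimately obtain \<alpha> where \<alpha>: "\<alpha> \<in> sets m" "K = char_proj m \<alpha> ` L2 m"
    using masa_invariant_subspace[OF m] by metis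
  have "vanishes_on m n U \<alpha> \<beta>"
    unfolding vanishes_on_def
  proof
    fix S assume S: "S \<in> U"
    show "block m n \<alpha> \<beta> S = op_zero m n"
    proof (rule bounded_ops_eqI[OF block_bounded[OF \<alpha>(1) \<beta> bimodule_bounded[OF U S]] op_zero_bounded])
      fix u assume u: "u \<in> L2 m"
      then have "char_proj m \<alpha> u \<in> K"
        using \<alpha> by blast
      then show "block m n \<alpha> \<beta> S u = op_zero m n u"
        using u S by (simp add: K_iff block_apply op_zero_apply char_proj_def)
    qed
  qed
  then have V0: "vanishes_on m n V \<alpha> \<beta>"
    by (rule van[OF \<alpha>(1) \<beta>])
  show ?thesis
  proof (rule image_span_minimal[OF closed_subspace_image_span[OF U P]])
    fix S u assume S: "S \<in> V" and u: "u \<in> P ` L2 m"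
    have uL: "u \<in> L2 m"
      by (rule projection_range_subset[OF P u])
    have "mult_op n (indicator \<beta>) (S' u) = l2_zero n" if S': "S' \<in> U" for S'
      using image_span_superset[where m = m, OF S' u]
        in_K[OF bounded_ops_in_L2[OF bimodule_bounded[OF U S'] uL]] by blast
    then have "u \<in> K"
      using uL by (simp add: K_iff)
    then have "char_proj m \<alpha> u = u"
      using char_proj_range_iff(1)[OF \<alpha>(1) uL] \<alpha>(2) by blast
    moreover have "block m n \<alpha> \<beta> S u = l2_zero n"
      using V0 S uL by (simp add: vanishes_on_def op_zero_apply)
    ultimately have "mult_op n (indicator \<beta>) (S u) = l2_zero n"
      using uL by (simp add: block_apply char_proj_def)
    then show "S u \<in> image_span m n U P"
      using in_K[OF bounded_ops_in_L2[OF bimodule_bounded[OF V S] uL]] by blast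
  qed
qed

text \<open>
  \<open>U\<close> vanishes on \<open>\<alpha> \<times> \<beta>\<close> exactly if \<open>[U P(\<alpha>)]\<close> lies in the kernel of \<open>P(\<beta>)\<close>, which is closed.
\<close>

lemma image_span_subset_imp_vanishes_on:
  assumes U: "bimodule m n U" and V: "bimodule m n V"
    and sub: "image_span m n V (char_proj m \<alpha>) \<subseteq> image_span m n U (char_proj m \<alpha>)"
    and \<alpha>: "\<alpha> \<in> sets m" and \<beta>: "\<beta> \<in> sets n" and van: "vanishes_on m n U \<alpha> \<beta>"
  shows "vanishes_on m n V \<alpha> \<beta>"
proof -
  note b = ess_bounded_indicator[OF \<beta>]
  have "image_span m n U (char_proj m \<alpha>) \<subseteq> {w \<in> L2 n. mult_op n (indicator \<beta>) w = l2_zero n}"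
  proof (rule image_span_minimal[OF closed_subspace_kernel[OF mult_op_bounded[OF b]]])
    fix S u assume S: "S \<in> U" and u: "u \<in> char_proj m \<alpha> ` L2 m"
    have uL: "u \<in> L2 m"
      by (rule projection_range_subset[OF char_proj_in_projections[OF \<alpha>] u])
    have "mult_op n (indicator \<beta>) (S u) = block m n \<alpha> \<beta> S u"
      using char_proj_range_iff(1)[OF \<alpha> uL] u uL by (simp add: block_apply char_proj_def)
    also have "\<dots> = l2_zero n"
      using van S uL by (simp add: vanishes_on_def op_zero_apply)
    finally show "S u \<in> {w \<in> L2 n. mult_op n (indicator \<beta>) w = l2_zero n}"
      using bounded_ops_in_L2[OF bimodule_bounded[OF U S] uL] by simp
  qed
  then have ker: "mult_op n (indicator \<beta>) w = l2_zero n" if "w \<in> image_span m n V (char_proj m \<alpha>)" for w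
    using sub that by blast
  show ?thesis
    unfolding vanishes_on_def
  proof
    fix S assume S: "S \<in> V"
    show "block m n \<alpha> \<beta> S = op_zero m n"
    proof (rule bounded_ops_eqI[OF block_bounded[OF \<alpha> \<beta> bimodule_bounded[OF V S]] op_zero_bounded])
      fix u assume u: "u \<in> L2 m"
      have "S (char_proj m \<alpha> u) \<in> image_span m n V (char_proj m \<alpha>)"
        using S u by (intro image_span_superset) auto
      then show "block m n \<alpha> \<beta> S u = op_zero m n u"
        using ker u by (simp add: block_apply op_zero_apply char_proj_def)
    qed
  qed
qed

lemma op_Map_eq_iff:
  assumes m: "finite_measure m" and n: "finite_measure n"
    and U: "bimodule m n U" and V: "bimodule m n V"
  shows "op_Map m n U = op_Map m n V \<longleftrightarrow>
    (\<forall>\<alpha>\<in>sets m. \<forall>\<beta>\<in>sets n. vanishes_on m n U \<alpha> \<beta> \<longleftrightarrow> vanishes_on m n V \<alpha> \<beta>)"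
proof
  assume eq: "op_Map m n U = op_Map m n V"
  have "image_span m n U (char_proj m \<alpha>) = image_span m n V (char_proj m \<alpha>)" if "\<alpha> \<in> sets m" for \<alpha>
    using op_Map_range(2)[OF n U char_proj_in_projections[OF that]]
      op_Map_range(2)[OF n V char_proj_in_projections[OF that]] eq by simp
  then show "\<forall>\<alpha>\<in>sets m. \<forall>\<beta>\<in>sets n. vanishes_on m n U \<alpha> \<beta> \<longleftrightarrow> vanishes_on m n V \<alpha> \<beta>"
    by (auto intro: image_span_subset_imp_vanishes_on[OF U V equalityD2]
        image_span_subset_imp_vanishes_on[OF V U equalityD1])
next
  assume van: "\<forall>\<alpha>\<in>sets m. \<forall>\<beta>\<in>sets n. vanishes_on m n U \<alpha> \<beta> \<longleftrightarrow> vanishes_on m n V \<alpha> \<beta>"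
  have "image_span m n U P = image_span m n V P" if "P \<in> projections m" for P
  proof
    show "image_span m n U P \<subseteq> image_span m n V P"
      by (rule vanishes_on_imp_image_span_subset[OF m n V U _ that]) (simp add: van)
    show "image_span m n V P \<subseteq> image_span m n U P"
      by (rule vanishes_on_imp_image_span_subset[OF m n U V _ that]) (simp add: van)
  qed
  then show "op_Map m n U = op_Map m n V"
    unfolding op_Map_def image_span_def[symmetric] by (intro restrict_ext) simp
qed

section \<open>The ultraweak topology\<close>

definition ultraweak_functional ::
  "'b measure \<Rightarrow> (nat \<Rightarrow> ('a \<Rightarrow> complex) set) \<Rightarrow> (nat \<Rightarrow> ('b \<Rightarrow> complex) set) \<Rightarrow> ('a, 'b) l2_op \<Rightarrow> complex"
  where "ultraweak_functional n x y T = (\<Sum>k. l2_inner n (T (x k)) (y k))"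

lemma l2_square_summable_in_L2: "l2_square_summable m x \<Longrightarrow> x k \<in> L2 m"
  by (auto simp: l2_square_summable_def)

lemma l2_square_summableI:
  "(\<And>k. x k \<in> L2 m) \<Longrightarrow> summable (\<lambda>k. (l2_norm m (x k))\<^sup>2) \<Longrightarrow> l2_square_summable m x"
  by (auto simp: l2_square_summable_def)

lemma l2_square_summable_image:
  assumes x: "l2_square_summable m x" and T: "T \<in> bounded_ops m n"
  shows "l2_square_summable n (\<lambda>k. T (x k))"
proof (rule l2_square_summableI)
  note xk = l2_square_summable_in_L2[OF x]
  show "T (x k) \<in> L2 n" for k
    by (rule bounded_ops_in_L2[OF T xk])
  obtain C where C: "0 \<le> C" "\<And>u. u \<in> L2 m \<Longrightarrow> l2_norm n (T u) \<le> C * l2_norm m u"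
    using bounded_opsE[OF T] by blast
  have le: "(l2_norm n (T (x k)))\<^sup>2 \<le> C\<^sup>2 * (l2_norm m (x k))\<^sup>2" for k
    unfolding power_mult_distrib[symmetric] by (rule power_mono[OF C(2)[OF xk] l2_norm_nonneg])
  show "summable (\<lambda>k. (l2_norm n (T (x k)))\<^sup>2)"
  proof (rule summable_comparison_test')
    show "summable (\<lambda>k. C\<^sup>2 * (l2_norm m (x k))\<^sup>2)"
      using x by (intro summable_mult) (simp add: l2_square_summable_def)
    show "norm ((l2_norm n (T (x k)))\<^sup>2) \<le> C\<^sup>2 * (l2_norm m (x k))\<^sup>2" for k
      using le[of k] by simp
  qed
qed

lemma summable_ultraweak:
  assumes x: "l2_square_summable m x" and y: "l2_square_summable n y" and T: "T \<in> bounded_ops m n"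
  shows "summable (\<lambda>k. l2_inner n (T (x k)) (y k))"
proof (rule summable_comparison_test')
  note Tx = l2_square_summable_image[OF x T]
  show "summable (\<lambda>k. (l2_norm n (T (x k)))\<^sup>2 + (l2_norm n (y k))\<^sup>2)"
    using Tx y by (intro summable_add) (simp_all add: l2_square_summable_def)
  show "norm (l2_inner n (T (x k)) (y k)) \<le> (l2_norm n (T (x k)))\<^sup>2 + (l2_norm n (y k))\<^sup>2" for k
    by (rule norm_l2_inner_le[OF l2_square_summable_in_L2[OF Tx] l2_square_summable_in_L2[OF y]])
qed

lemma l2_square_summable_single:
  "u \<in> L2 m \<Longrightarrow> l2_square_summable m (\<lambda>k. if k = 0 then u else l2_zero m)"
  by (rule l2_square_summableI)
    (auto simp: l2_norm_zero intro!: summable_finite[of "{0}"] split: if_splits)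

lemma l2_inner_zero: "u \<in> L2 m \<Longrightarrow> l2_inner m (l2_zero m) u = 0"
  using l2_inner_scale[of "l2_zero m" m u 0] by (simp add: l2_scale_zero)

text \<open>
  Vector functionals are ultraweak functionals whose series has a single nonzero term.
\<close>

lemma ultraweak_functional_single:
  assumes "u \<in> L2 m" "v \<in> L2 n" "T \<in> bounded_ops m n"
  shows "ultraweak_functional n (\<lambda>k. if k = 0 then u else l2_zero m) (\<lambda>k. if k = 0 then v else l2_zero n) T
    = l2_inner n (T u) v"
  unfolding ultraweak_functional_def
  by (subst suminf_finite[of "{0}"])
    (simp_all add: bounded_ops_zero[OF assms(3)] l2_inner_zero)

lemma ultraweak_topology_altdef:
  "ultraweak_topology m n = topology_generated_by
     {{T \<in> bounded_ops m n. ultraweak_functional n x y T \<in> G} | x y G.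
        l2_square_summable m x \<and> l2_square_summable n y \<and> open G}"
  by (simp add: ultraweak_topology_def ultraweak_functional_def)

lemma openin_ultraweak_basic:
  assumes "l2_square_summable m x" "l2_square_summable n y" "open G"
  shows "openin (ultraweak_topology m n) {T \<in> bounded_ops m n. ultraweak_functional n x y T \<in> G}"
  unfolding ultraweak_topology_altdef by (rule topology_generated_by_Basis) (use assms in blast)

lemma topspace_ultraweak: "topspace (ultraweak_topology m n) = bounded_ops m n"
proof
  show "topspace (ultraweak_topology m n) \<subseteq> bounded_ops m n"
    unfolding ultraweak_topology_altdef topology_generated_by_topspace by blast
  show "bounded_ops m n \<subseteq> topspace (ultraweak_topology m n)"
    using openin_subset[OF openin_ultraweak_basic[OF l2_square_summable_single l2_square_summable_single open_UNIV,
      of "l2_zero m" m "l2_zero n" n]] by simp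
qed

lemma continuous_map_ultraweak_functional:
  assumes "l2_square_summable m x" "l2_square_summable n y"
  shows "continuous_map (ultraweak_topology m n) euclidean (ultraweak_functional n x y)"
  unfolding continuous_map topspace_ultraweak
  using openin_ultraweak_basic[OF assms] by simp

lemma continuous_map_into_ultraweak:
  assumes F: "\<And>T. T \<in> topspace X \<Longrightarrow> F T \<in> bounded_ops m n"
    and cont: "\<And>x y. l2_square_summable m x \<Longrightarrow> l2_square_summable n y \<Longrightarrow>
      continuous_map X euclidean (\<lambda>T. ultraweak_functional n x y (F T))"
  shows "continuous_map X (ultraweak_topology m n) F"
  unfolding ultraweak_topology_altdef
proof (rule continuous_on_generated_topo)
  fix O' assume "O' \<in> {{T \<in> bounded_ops m n. ultraweak_functional n x y T \<in> G} | x y G.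
        l2_square_summable m x \<and> l2_square_summable n y \<and> open G}"
  then obtain x y G where xy: "l2_square_summable m x" "l2_square_summable n y" "open G"
    and O': "O' = {T \<in> bounded_ops m n. ultraweak_functional n x y T \<in> G}"
    by blast
  have "openin X {T \<in> topspace X. ultraweak_functional n x y (F T) \<in> G}"
    by (rule openin_continuous_map_preimage[OF cont[OF xy(1,2)]]) (use xy(3) in simp)
  moreover have "F -` O' \<inter> topspace X = {T \<in> topspace X. ultraweak_functional n x y (F T) \<in> G}"
    using F by (auto simp: O')
  ultimately show "openin X (F -` O' \<inter> topspace X)"
    by simp
next
  show "F ` topspace X \<subseteq> \<Union>{{T \<in> bounded_ops m n. ultraweak_functional n x y T \<in> G} | x y G.
        l2_square_summable m x \<and> l2_square_summable n y \<and> open G}"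
    using F topspace_ultraweak[of m n]
    unfolding ultraweak_topology_altdef topology_generated_by_topspace by blast
qed

text \<open>
  The multiplications move to the vectors, the left one as its adjoint, so every ultraweak
  functional of the sandwich is an ultraweak functional of the operator.
\<close>

lemma continuous_map_sandwich:
  assumes "ess_bounded m \<phi>" "ess_bounded n \<psi>"
  shows "continuous_map (ultraweak_topology m n) (ultraweak_topology m n) (sandwich m n \<phi> \<psi>)"
proof (rule continuous_map_into_ultraweak)
  show "sandwich m n \<phi> \<psi> T \<in> bounded_ops m n" if "T \<in> topspace (ultraweak_topology m n)" for T
    using that by (simp add: topspace_ultraweak sandwich_bounded assms)
  fix x y assume x: "l2_square_summable m x" and y: "l2_square_summable n y"
  let ?x = "\<lambda>k. mult_op m \<phi> (x k)" and ?y = "\<lambda>k. mult_op n (\<lambda>t. cnj (\<psi> t)) (y k)"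
  have "continuous_map (ultraweak_topology m n) euclidean (ultraweak_functional n ?x ?y)" (is "continuous_map _ _ ?f")
    by (intro continuous_map_ultraweak_functional l2_square_summable_image[OF x]
        l2_square_summable_image[OF y] mult_op_bounded ess_bounded_cnj assms)
  moreover have "ultraweak_functional n x y (sandwich m n \<phi> \<psi> T) = ultraweak_functional n ?x ?y T"
    if T: "T \<in> bounded_ops m n" for T
    unfolding ultraweak_functional_def
    by (simp add: sandwich_apply l2_square_summable_in_L2[OF x] l2_square_summable_in_L2[OF y]
        l2_inner_mult_op[OF assms(2)] bounded_ops_in_L2[OF T] assms)
  ultimately show "continuous_map (ultraweak_topology m n) euclidean
      (\<lambda>T. ultraweak_functional n x y (sandwich m n \<phi> \<psi> T))"
    by (auto intro: continuous_map_eq[of _ _ ?f] simp: topspace_ultraweak)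
qed

lemma continuous_map_op_add:
  assumes S: "S \<in> bounded_ops m n"
  shows "continuous_map (ultraweak_topology m n) (ultraweak_topology m n) (op_add m n S)"
proof (rule continuous_map_into_ultraweak)
  show "op_add m n S T \<in> bounded_ops m n" if "T \<in> topspace (ultraweak_topology m n)" for T
    using that by (simp add: topspace_ultraweak op_add_bounded S)
  fix x y assume x: "l2_square_summable m x" and y: "l2_square_summable n y"
  have "continuous_map (ultraweak_topology m n) euclidean
      (\<lambda>T. ultraweak_functional n x y S + ultraweak_functional n x y T)" (is "continuous_map _ _ ?f")
    by (intro continuous_map_add continuous_map_ultraweak_functional x y) simp
  moreover have "ultraweak_functional n x y (op_add m n S T)
      = ultraweak_functional n x y S + ultraweak_functional n x y T" if T: "T \<in> bounded_ops m n" for T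
    unfolding ultraweak_functional_def
    by (subst suminf_add[OF summable_ultraweak[OF x y S] summable_ultraweak[OF x y T]])
      (simp add: op_add_apply l2_square_summable_in_L2[OF x] l2_square_summable_in_L2[OF y] l2_inner_add
        bounded_ops_in_L2[OF T] bounded_ops_in_L2[OF S])
  ultimately show "continuous_map (ultraweak_topology m n) euclidean
      (\<lambda>T. ultraweak_functional n x y (op_add m n S T))"
    by (auto intro: continuous_map_eq[of _ _ ?f] simp: topspace_ultraweak)
qed

text \<open>
  The vector functionals are ultraweakly continuous and separate operators, so the zero operator
  is their common zero.
\<close>

lemma closedin_op_zero: "closedin (ultraweak_topology m n) {op_zero m n}"
proof -
  let ?f = "\<lambda>u v. ultraweak_functional n (\<lambda>k. if k = 0 then u else l2_zero m) (\<lambda>k. if k = 0 then v else l2_zero n)"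
  let ?Z = "\<lambda>u v. {T \<in> bounded_ops m n. ?f u v T \<in> {0}}"
  have "closedin (ultraweak_topology m n) (?Z u v)" if "u \<in> L2 m" "v \<in> L2 n" for u v
    using closedin_continuous_map_preimage[OF continuous_map_ultraweak_functional[OF
        l2_square_summable_single[OF that(1)] l2_square_summable_single[OF that(2)]], of "{0}"]
    by (simp add: topspace_ultraweak)
  then have "closedin (ultraweak_topology m n) (\<Inter>p\<in>L2 m \<times> L2 n. ?Z (fst p) (snd p))"
    by (intro closedin_INT) (auto intro: l2_zero_in_L2)
  moreover have "(\<Inter>p\<in>L2 m \<times> L2 n. ?Z (fst p) (snd p)) = {op_zero m n}"
  proof (intro subset_antisym subsetI)
    fix T assume T: "T \<in> (\<Inter>p\<in>L2 m \<times> L2 n. ?Z (fst p) (snd p))"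
    have Tb: "T \<in> bounded_ops m n"
      using INT_D[OF T, of "(l2_zero m, l2_zero n)"] by simp
    have "T = op_zero m n"
    proof (rule bounded_ops_eqI[OF Tb op_zero_bounded])
      fix u assume u: "u \<in> L2 m"
      have "l2_inner n (T u) v = l2_inner n (l2_zero n) v" if v: "v \<in> L2 n" for v
        using INT_D[OF T, of "(u, v)", unfolded fst_conv snd_conv] u v ultraweak_functional_single[OF u v Tb]
        by (simp add: l2_inner_zero)
      then show "T u = op_zero m n u"
        using L2_eqI_inner[OF bounded_ops_in_L2[OF Tb u] l2_zero_in_L2] u by (simp add: op_zero_apply)
    qed
    then show "T \<in> {op_zero m n}"
      by simp
  next
    fix T assume "T \<in> {op_zero m n}"
    then show "T \<in> (\<Inter>p\<in>L2 m \<times> L2 n. ?Z (fst p) (snd p))"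
      by (auto simp: op_zero_bounded ultraweak_functional_single op_zero_apply l2_inner_zero)
  qed
  ultimately show ?thesis
    by simp
qed

definition closed_bimodule :: "'a measure \<Rightarrow> 'b measure \<Rightarrow> ('a, 'b) l2_op set \<Rightarrow> bool" where
  "closed_bimodule m n U \<longleftrightarrow> bimodule m n U \<and> closedin (ultraweak_topology m n) U"

text \<open>
  Sandwiches and addition of a fixed operator are continuous. As addition is used in one
  variable at a time, closure under sums takes two steps: first for one summand in \<open>U\<close>, then for
  both in the closure.
\<close>

lemma closed_bimodule_closure:
  assumes U: "bimodule m n U"
  shows "closed_bimodule m n (ultraweak_topology m n closure_of U)"
proof -
  let ?X = "ultraweak_topology m n" and ?cl = "ultraweak_topology m n closure_of U"
  have bd: "T \<in> bounded_ops m n" if "T \<in> ?cl" for T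
    using that closure_of_subset_topspace[of ?X U] by (auto simp: topspace_ultraweak)
  have "U \<subseteq> topspace ?X"
    using bimodule_bounded[OF U] by (auto simp: topspace_ultraweak)
  then have sub: "U \<subseteq> ?cl"
    by (rule closure_of_subset)
  have image: "F T \<in> ?cl"
    if F: "continuous_map ?X ?X F" and FU: "\<And>S. S \<in> U \<Longrightarrow> F S \<in> ?cl" and T: "T \<in> ?cl" for F T
  proof -
    have "F T \<in> F ` ?cl"
      using T by simp
    also have "\<dots> \<subseteq> ?X closure_of F ` U"
      using F by (rule continuous_map_image_closure_subset)
    also have "\<dots> \<subseteq> ?cl"
      by (rule closure_of_minimal) (use FU in auto)
    finally show ?thesis .
  qed
  have add1: "op_add m n S T \<in> ?cl" if S: "S \<in> U" and T: "T \<in> ?cl" for S T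
    using image[OF continuous_map_op_add[OF bimodule_bounded[OF U S]] _ T] sub bimodule_add[OF U S] by blast
  have "bimodule m n ?cl"
  proof (rule bimoduleI)
    show "op_zero m n \<in> ?cl"
      using bimodule_zero[OF U] sub by blast
    show "op_add m n S T \<in> ?cl" if S: "S \<in> ?cl" and T: "T \<in> ?cl" for S T
    proof (rule image[OF continuous_map_op_add[OF bd[OF S]] _ T])
      show "op_add m n S R \<in> ?cl" if "R \<in> U" for R
        using add1[OF that S] by (simp add: op_add_commute)
    qed
    show "sandwich m n \<phi> \<psi> T \<in> ?cl" if T: "T \<in> ?cl" and "ess_bounded m \<phi>" "ess_bounded n \<psi>" for T \<phi> \<psi>
      using image[OF continuous_map_sandwich[OF that(2,3)] _ T] sub bimodule_sandwich[OF U _ that(2,3)] by blast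
  qed (rule bd)
  then show ?thesis
    by (simp add: closed_bimodule_def)
qed

section \<open>Operators supported on a set\<close>

lemma regular_borel_measure_finite:
  fixes m :: "'a::compact_metric_space measure"
  assumes "regular_borel_measure m"
  shows "finite_measure m"
proof
  have "sets m = sets borel"
    using assms by (simp add: regular_borel_measure_def)
  then have "space m = UNIV"
    using sets_eq_imp_space_eq by fastforce
  moreover have "emeasure m UNIV < \<infinity>"
    using assms compact_UNIV unfolding regular_borel_measure_def by blast
  ultimately show "emeasure m (space m) \<noteq> \<infinity>"
    by simp
qed

lemma marginally_null_subset:
  "marginally_null m n E \<Longrightarrow> F \<subseteq> E \<Longrightarrow> marginally_null m n F"
  unfolding marginally_null_def by (meson order_trans)

lemma marginally_null_Un:
  assumes "marginally_null m n E" "marginally_null m n F"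
  shows "marginally_null m n (E \<union> F)"
proof -
  obtain A B where AB: "A \<in> null_sets m" "B \<in> null_sets n" "E \<subseteq> A \<times> space n \<union> space m \<times> B"
    using assms(1) by (auto simp: marginally_null_def)
  obtain A' B' where AB': "A' \<in> null_sets m" "B' \<in> null_sets n" "F \<subseteq> A' \<times> space n \<union> space m \<times> B'"
    using assms(2) by (auto simp: marginally_null_def)
  have "A \<union> A' \<in> null_sets m" "B \<union> B' \<in> null_sets n"
    using AB AB' by auto
  moreover have "E \<union> F \<subseteq> (A \<union> A') \<times> space n \<union> space m \<times> (B \<union> B')"
    using AB(3) AB'(3) by blast
  ultimately show ?thesis
    unfolding marginally_null_def by blast
qed

lemma M_max_iff:
  "T \<in> M_max m n \<kappa> \<longleftrightarrow> T \<in> bounded_ops m n \<and>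
    (\<forall>\<alpha>\<in>sets m. \<forall>\<beta>\<in>sets n. marginally_null m n ((\<alpha> \<times> \<beta>) \<inter> \<kappa>) \<longrightarrow> block m n \<alpha> \<beta> T = op_zero m n)"
  by (simp add: M_max_def block_def sandwich_def char_proj_def)

lemma M_max_mono: "\<kappa> \<subseteq> \<kappa>' \<Longrightarrow> M_max m n \<kappa> \<subseteq> M_max m n \<kappa>'"
  using marginally_null_subset[OF _ Int_mono[OF order_refl]] unfolding M_max_iff subset_iff by meson

text \<open>
  The space is an intersection of preimages of the zero operator under block maps, which are
  ultraweakly continuous and commute with multiplications from both sides.
\<close>

lemma closed_bimodule_M_max: "closed_bimodule m n (M_max m n \<kappa>)"
proof -
  define R where "R = {(\<alpha>, \<beta>). \<alpha> \<in> sets m \<and> \<beta> \<in> sets n \<and> marginally_null m n ((\<alpha> \<times> \<beta>) \<inter> \<kappa>)}"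
  have "({}, {}) \<in> R"
    by (auto simp: R_def marginally_null_def intro!: bexI[of _ "{}"])
  have "M_max m n \<kappa> = (\<Inter>(\<alpha>, \<beta>)\<in>R. {T \<in> bounded_ops m n. block m n \<alpha> \<beta> T \<in> {op_zero m n}})"
    (is "_ = ?I")
  proof (intro subset_antisym subsetI)
    fix T assume T: "T \<in> ?I"
    have "T \<in> bounded_ops m n"
      using INT_D[OF T \<open>({}, {}) \<in> R\<close>] by simp
    then show "T \<in> M_max m n \<kappa>"
      using T by (auto simp: M_max_iff R_def)
  qed (auto simp: M_max_iff R_def)
  moreover have "closedin (ultraweak_topology m n)
      (\<Inter>(\<alpha>, \<beta>)\<in>R. {T \<in> bounded_ops m n. block m n \<alpha> \<beta> T \<in> {op_zero m n}})"
  proof (rule closedin_INT)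
    show "R \<noteq> {}"
      using \<open>({}, {}) \<in> R\<close> by blast
    fix p assume "p \<in> R"
    then obtain \<alpha> \<beta> where p: "p = (\<alpha>, \<beta>)" "\<alpha> \<in> sets m" "\<beta> \<in> sets n"
      by (auto simp: R_def)
    have "closedin (ultraweak_topology m n)
        {T \<in> topspace (ultraweak_topology m n). block m n \<alpha> \<beta> T \<in> {op_zero m n}}"
      unfolding block_def
      by (rule closedin_continuous_map_preimage[OF continuous_map_sandwich closedin_op_zero])
        (simp_all add: ess_bounded_indicator p)
    then show "closedin (ultraweak_topology m n)
        (case p of (\<alpha>, \<beta>) \<Rightarrow> {T \<in> bounded_ops m n. block m n \<alpha> \<beta> T \<in> {op_zero m n}})"
      by (simp add: p(1) topspace_ultraweak)
  qed
  ultimately have "closedin (ultraweak_topology m n) (M_max m n \<kappa>)"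
    by simp
  moreover have "bimodule m n (M_max m n \<kappa>)"
  proof (rule bimoduleI)
    show "T \<in> bounded_ops m n" if "T \<in> M_max m n \<kappa>" for T
      using that by (simp add: M_max_iff)
    show "op_zero m n \<in> M_max m n \<kappa>"
      by (simp add: M_max_iff op_zero_bounded block_zero)
    show "op_add m n S T \<in> M_max m n \<kappa>" if "S \<in> M_max m n \<kappa>" "T \<in> M_max m n \<kappa>" for S T
      using that by (simp add: M_max_iff op_add_bounded block_add op_add_zero op_zero_bounded)
    show "sandwich m n \<phi> \<psi> T \<in> M_max m n \<kappa>"
      if "T \<in> M_max m n \<kappa>" "ess_bounded m \<phi>" "ess_bounded n \<psi>" for T \<phi> \<psi>
      using that by (simp add: M_max_iff sandwich_bounded block_sandwich_commute sandwich_zero)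
  qed
  ultimately show ?thesis
    by (simp add: closed_bimodule_def)
qed

lemmas bimodule_M_max = closed_bimodule_M_max[unfolded closed_bimodule_def, THEN conjunct1]

text \<open>
  The maximal bimodule itself always satisfies the conditions that synthesis imposes, so only
  uniqueness is left, and the map may be replaced by the rectangles on which a bimodule vanishes.
\<close>

lemma synthetic_iff_vanishes_on:
  assumes "finite_measure m" "finite_measure n"
  shows "synthetic m n \<kappa> \<longleftrightarrow>
    (\<forall>U. closed_bimodule m n U \<longrightarrow>
      (\<forall>\<alpha>\<in>sets m. \<forall>\<beta>\<in>sets n. vanishes_on m n U \<alpha> \<beta> \<longleftrightarrow> vanishes_on m n (M_max m n \<kappa>) \<alpha> \<beta>) \<longrightarrow>
      U = M_max m n \<kappa>)"
proof -
  have "op_subspace m n U \<and> closedin (ultraweak_topology m n) U \<and> masa_bimodule m n U \<and>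
      op_Map m n U = op_Map m n (M_max m n \<kappa>) \<longleftrightarrow>
    closed_bimodule m n U \<and>
      (\<forall>\<alpha>\<in>sets m. \<forall>\<beta>\<in>sets n. vanishes_on m n U \<alpha> \<beta> \<longleftrightarrow> vanishes_on m n (M_max m n \<kappa>) \<alpha> \<beta>)" for U
    using op_Map_eq_iff[OF assms _ bimodule_M_max] unfolding closed_bimodule_def bimodule_def by blast
  then show ?thesis
    unfolding synthetic_def using closed_bimodule_M_max by blast
qed

lemma vanishes_on_M_max:
  assumes "\<alpha> \<in> sets m" "\<beta> \<in> sets n" "marginally_null m n ((\<alpha> \<times> \<beta>) \<inter> \<kappa>)"
  shows "vanishes_on m n (M_max m n \<kappa>) \<alpha> \<beta>"
  using assms by (simp add: vanishes_on_def M_max_iff)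

lemma M_maxI_vanishes_on:
  assumes "\<And>T. T \<in> U \<Longrightarrow> T \<in> bounded_ops m n"
    and "\<And>\<alpha> \<beta>. \<alpha> \<in> sets m \<Longrightarrow> \<beta> \<in> sets n \<Longrightarrow> vanishes_on m n (M_max m n \<kappa>) \<alpha> \<beta> \<Longrightarrow> vanishes_on m n U \<alpha> \<beta>"
  shows "U \<subseteq> M_max m n \<kappa>"
proof
  fix T assume T: "T \<in> U"
  have "block m n \<alpha> \<beta> T = op_zero m n"
    if "\<alpha> \<in> sets m" "\<beta> \<in> sets n" "marginally_null m n ((\<alpha> \<times> \<beta>) \<inter> \<kappa>)" for \<alpha> \<beta>
    using assms(2)[OF that(1,2) vanishes_on_M_max[OF that]] T by (simp add: vanishes_on_def)
  then show "T \<in> M_max m n \<kappa>"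
    using assms(1)[OF T] by (simp add: M_max_iff)
qed

text \<open>
  If \<open>R\<close> is null relative to \<open>\<kappa>\<^sub>1\<close> and \<open>R'\<close> relative to \<open>\<kappa>\<^sub>2\<close>, then \<open>R \<inter> R'\<close> is null relative to the
  union, and a block over \<open>R'\<close> of a block over \<open>R\<close> is a block over \<open>R \<inter> R'\<close>.
\<close>

lemma block_in_M_max_of_Un:
  assumes T: "T \<in> M_max m n (\<kappa>\<^sub>1 \<union> \<kappa>\<^sub>2)" and \<alpha>: "\<alpha> \<in> sets m" and \<beta>: "\<beta> \<in> sets n"
    and null: "marginally_null m n ((\<alpha> \<times> \<beta>) \<inter> \<kappa>\<^sub>1)"
  shows "block m n \<alpha> \<beta> T \<in> M_max m n \<kappa>\<^sub>2"
proof -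
  have Tb: "T \<in> bounded_ops m n"
    using T by (simp add: M_max_iff)
  have "block m n \<alpha>' \<beta>' (block m n \<alpha> \<beta> T) = op_zero m n"
    if \<alpha>': "\<alpha>' \<in> sets m" and \<beta>': "\<beta>' \<in> sets n" and null': "marginally_null m n ((\<alpha>' \<times> \<beta>') \<inter> \<kappa>\<^sub>2)" for \<alpha>' \<beta>'
  proof -
    have "marginally_null m n (((\<alpha>' \<inter> \<alpha>) \<times> (\<beta>' \<inter> \<beta>)) \<inter> (\<kappa>\<^sub>1 \<union> \<kappa>\<^sub>2))"
      by (rule marginally_null_subset[OF marginally_null_Un[OF null null']]) blast
    then show ?thesis
      using T \<alpha> \<beta> \<alpha>' \<beta>' by (simp add: block_block Tb M_max_iff)
  qed
  then show ?thesis
    using block_bounded[OF \<alpha> \<beta> Tb] by (simp add: M_max_iff)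
qed

text \<open>
  Let \<open>S\<close> be a block over \<open>\<alpha> \<times> \<beta>\<close> of an operator supported on the union. The blocks of \<open>S\<close> over
  rectangles null relative to \<open>\<kappa>\<^sub>1\<close> are supported on \<open>\<kappa>\<^sub>2\<close> and live in \<open>\<alpha> \<times> \<beta>\<close>, so they are zero. This
  means that \<open>S\<close> is supported on \<open>\<kappa>\<^sub>1\<close>, so \<open>S\<close> is zero as well.
\<close>

lemma vanishes_on_M_max_Un:
  assumes \<alpha>: "\<alpha> \<in> sets m" and \<beta>: "\<beta> \<in> sets n"
    and van\<^sub>1: "vanishes_on m n (M_max m n \<kappa>\<^sub>1) \<alpha> \<beta>" and van\<^sub>2: "vanishes_on m n (M_max m n \<kappa>\<^sub>2) \<alpha> \<beta>"
  shows "vanishes_on m n (M_max m n (\<kappa>\<^sub>1 \<union> \<kappa>\<^sub>2)) \<alpha> \<beta>"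
  unfolding vanishes_on_def
proof
  fix T assume T: "T \<in> M_max m n (\<kappa>\<^sub>1 \<union> \<kappa>\<^sub>2)"
  then have Tb: "T \<in> bounded_ops m n"
    by (simp add: M_max_iff)
  let ?S = "block m n \<alpha> \<beta> T"
  have S: "?S \<in> M_max m n (\<kappa>\<^sub>1 \<union> \<kappa>\<^sub>2)"
    by (rule bimodule_block[OF bimodule_M_max T \<alpha> \<beta>])
  have "block m n \<alpha>' \<beta>' ?S = op_zero m n"
    if \<alpha>': "\<alpha>' \<in> sets m" and \<beta>': "\<beta>' \<in> sets n" and null: "marginally_null m n ((\<alpha>' \<times> \<beta>') \<inter> \<kappa>\<^sub>1)" for \<alpha>' \<beta>'
  proof -
    have "block m n \<alpha>' \<beta>' ?S = block m n \<alpha> \<beta> (block m n \<alpha>' \<beta>' ?S)"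
      using \<alpha> \<beta> \<alpha>' \<beta>' Tb
      by (simp add: block_block block_bounded Int_left_commute[of \<alpha>] Int_left_commute[of \<beta>])
    also have "\<dots> = op_zero m n"
      using van\<^sub>2 block_in_M_max_of_Un[OF S \<alpha>' \<beta>' null] by (simp add: vanishes_on_def)
    finally show ?thesis .
  qed
  then have "?S \<in> M_max m n \<kappa>\<^sub>1"
    using block_bounded[OF \<alpha> \<beta> Tb] by (simp add: M_max_iff)
  then have "block m n \<alpha> \<beta> ?S = op_zero m n"
    using van\<^sub>1 by (simp add: vanishes_on_def)
  then show "?S = op_zero m n"
    using \<alpha> \<beta> Tb by (simp add: block_block)
qed


section \<open>Sums of spaces of supported operators\<close>

lemma op_set_plusI: "S \<in> U \<Longrightarrow> T \<in> V \<Longrightarrow> op_add m n S T \<in> op_set_plus m n U V"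
  by (auto simp: op_set_plus_def)

lemma bimodule_op_set_plus:
  assumes U: "bimodule m n U" and V: "bimodule m n V"
  shows "bimodule m n (op_set_plus m n U V)"
proof (rule bimoduleI)
  note bd = bimodule_bounded[OF U] bimodule_bounded[OF V]
  show "T \<in> bounded_ops m n" if "T \<in> op_set_plus m n U V" for T
    using that bd by (auto simp: op_set_plus_def op_add_bounded)
  show "op_zero m n \<in> op_set_plus m n U V"
    using op_set_plusI[OF bimodule_zero[OF U] bimodule_zero[OF V], of m n]
    by (simp add: op_add_zero op_zero_bounded)
  show "op_add m n S T \<in> op_set_plus m n U V" if ST: "S \<in> op_set_plus m n U V" "T \<in> op_set_plus m n U V" for S T
  proof -
    obtain A B where AB: "A \<in> U" "B \<in> V" "S = op_add m n A B"
      using ST(1) by (auto simp: op_set_plus_def)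
    obtain A' B' where AB': "A' \<in> U" "B' \<in> V" "T = op_add m n A' B'"
      using ST(2) by (auto simp: op_set_plus_def)
    have "op_add m n S T = op_add m n (op_add m n A A') (op_add m n B B')"
      using AB AB' bd by (simp add: op_add_swap)
    then show ?thesis
      using bimodule_add[OF U AB(1) AB'(1)] bimodule_add[OF V AB(2) AB'(2)]
      unfolding op_set_plus_def by blast
  qed
  show "sandwich m n \<phi> \<psi> T \<in> op_set_plus m n U V"
    if T: "T \<in> op_set_plus m n U V" and b: "ess_bounded m \<phi>" "ess_bounded n \<psi>" for T \<phi> \<psi>
  proof -
    obtain A B where AB: "A \<in> U" "B \<in> V" "T = op_add m n A B"
      using T by (auto simp: op_set_plus_def)
    have "sandwich m n \<phi> \<psi> T = op_add m n (sandwich m n \<phi> \<psi> A) (sandwich m n \<phi> \<psi> B)"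
      using AB bd b by (simp add: sandwich_add)
    then show ?thesis
      using bimodule_sandwich[OF U AB(1) b] bimodule_sandwich[OF V AB(2) b]
      unfolding op_set_plus_def by blast
  qed
qed

lemma op_set_plus_superset:
  assumes U: "bimodule m n U" and V: "bimodule m n V"
  shows "U \<subseteq> op_set_plus m n U V" "V \<subseteq> op_set_plus m n U V"
proof -
  show "U \<subseteq> op_set_plus m n U V"
    using op_set_plusI[OF _ bimodule_zero[OF V], of _ U m n] op_add_zero[OF bimodule_bounded[OF U]] by force
  show "V \<subseteq> op_set_plus m n U V"
    using op_set_plusI[OF bimodule_zero[OF U], of _ V m n] op_add_zero[OF bimodule_bounded[OF V]]
      op_add_commute[of m n "op_zero m n"] by force
qed

text \<open>
  The closure contains \<open>M\<^sub>1\<close> and \<open>M\<^sub>2\<close> and is contained in \<open>M\<close>, so it vanishes on the same rectangles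
  as \<open>M\<close> by \<open>vanishes_on_M_max_Un\<close>; synthesis then identifies the two.
\<close>

lemma synthetic_imp_M_max_sum_dense:
  assumes fin: "finite_measure m" "finite_measure n" and syn: "synthetic m n (\<kappa>\<^sub>1 \<union> \<kappa>\<^sub>2)"
  shows "ultraweak_topology m n closure_of op_set_plus m n (M_max m n \<kappa>\<^sub>1) (M_max m n \<kappa>\<^sub>2)
    = M_max m n (\<kappa>\<^sub>1 \<union> \<kappa>\<^sub>2)"
proof -
  let ?M\<^sub>1 = "M_max m n \<kappa>\<^sub>1" and ?M\<^sub>2 = "M_max m n \<kappa>\<^sub>2" and ?M = "M_max m n (\<kappa>\<^sub>1 \<union> \<kappa>\<^sub>2)"
  let ?W = "op_set_plus m n ?M\<^sub>1 ?M\<^sub>2"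
  let ?U = "ultraweak_topology m n closure_of ?W"
  have W: "bimodule m n ?W"
    by (rule bimodule_op_set_plus[OF bimodule_M_max bimodule_M_max])
  have "?W \<subseteq> ?M"
  proof
    fix R assume "R \<in> ?W"
    then obtain S T where ST: "S \<in> ?M\<^sub>1" "T \<in> ?M\<^sub>2" "R = op_add m n S T"
      by (auto simp: op_set_plus_def)
    have "S \<in> ?M" "T \<in> ?M"
      using ST M_max_mono[of \<kappa>\<^sub>1 "\<kappa>\<^sub>1 \<union> \<kappa>\<^sub>2" m n] M_max_mono[of \<kappa>\<^sub>2 "\<kappa>\<^sub>1 \<union> \<kappa>\<^sub>2" m n] by auto
    then show "R \<in> ?M"
      unfolding ST(3) by (rule bimodule_add[OF bimodule_M_max])
  qed
  then have U_le: "?U \<subseteq> ?M"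
    by (rule closure_of_minimal) (use closed_bimodule_M_max[of m n] in \<open>simp add: closed_bimodule_def\<close>)
  have "?W \<subseteq> ?U"
    by (rule closure_of_subset) (use bimodule_bounded[OF W] in \<open>auto simp: topspace_ultraweak\<close>)
  then have le_U: "?M\<^sub>1 \<subseteq> ?U" "?M\<^sub>2 \<subseteq> ?U"
    using op_set_plus_superset[OF bimodule_M_max[of m n \<kappa>\<^sub>1] bimodule_M_max[of m n \<kappa>\<^sub>2]] by auto
  have "vanishes_on m n ?U \<alpha> \<beta> \<longleftrightarrow> vanishes_on m n ?M \<alpha> \<beta>" if "\<alpha> \<in> sets m" "\<beta> \<in> sets n" for \<alpha> \<beta>
    using vanishes_on_M_max_Un[OF that] vanishes_on_mono[OF _ le_U(1)] vanishes_on_mono[OF _ le_U(2)]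
      vanishes_on_mono[OF _ U_le] by blast
  then show ?thesis
    using syn closed_bimodule_closure[OF W] unfolding synthetic_iff_vanishes_on[OF fin] by blast
qed

text \<open>
  Synthesis of \<open>\<kappa>\<^sub>1\<close> reduces the claim to showing that \<open>M\<^sub>1\<close> vanishes on every rectangle \<open>\<alpha> \<times> \<beta>\<close> on
  which \<open>V \<inter> M\<^sub>1\<close> vanishes. Over such a rectangle the blocks of \<open>V\<close>, and then those of \<open>M\<^sub>1\<close>, turn out
  to be supported on \<open>\<kappa>\<^sub>2\<close>, and synthesis of \<open>\<kappa>\<^sub>2\<close> puts all blocks of \<open>M\<^sub>2\<close> into \<open>V\<close>.
\<close>

lemma synthetic_piece_subset:
  assumes fin: "finite_measure m" "finite_measure n"
    and syn\<^sub>1: "synthetic m n \<kappa>\<^sub>1" and syn\<^sub>2: "synthetic m n \<kappa>\<^sub>2"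
    and V: "closed_bimodule m n V"
    and van: "\<And>\<alpha> \<beta>. \<alpha> \<in> sets m \<Longrightarrow> \<beta> \<in> sets n \<Longrightarrow>
      vanishes_on m n V \<alpha> \<beta> \<longleftrightarrow> vanishes_on m n (M_max m n (\<kappa>\<^sub>1 \<union> \<kappa>\<^sub>2)) \<alpha> \<beta>"
  shows "M_max m n \<kappa>\<^sub>1 \<subseteq> V"
proof -
  let ?M\<^sub>1 = "M_max m n \<kappa>\<^sub>1" and ?M\<^sub>2 = "M_max m n \<kappa>\<^sub>2" and ?M = "M_max m n (\<kappa>\<^sub>1 \<union> \<kappa>\<^sub>2)"
  have Vb: "bimodule m n V" and Vc: "closedin (ultraweak_topology m n) V"
    using V by (auto simp: closed_bimodule_def)
  note V_bd = bimodule_bounded[OF Vb]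
  have M_closed: "closedin (ultraweak_topology m n) (M_max m n \<kappa>)" for \<kappa>
    using closed_bimodule_M_max[of m n] by (simp add: closed_bimodule_def)
  have VM: "V \<subseteq> ?M"
    by (rule M_maxI_vanishes_on[OF V_bd]) (simp_all add: van)
  have M1_M: "?M\<^sub>1 \<subseteq> ?M" and M2_M: "?M\<^sub>2 \<subseteq> ?M"
    by (rule M_max_mono, blast)+
  have "vanishes_on m n ?M\<^sub>1 \<alpha> \<beta>" if \<alpha>: "\<alpha> \<in> sets m" and \<beta>: "\<beta> \<in> sets n"
    and van\<^sub>1: "vanishes_on m n (V \<inter> ?M\<^sub>1) \<alpha> \<beta>" for \<alpha> \<beta>
  proof -
    \<comment> \<open>a block of \<open>S\<close> over a rectangle null relative to \<open>\<kappa>\<^sub>2\<close> is in \<open>V \<inter> M\<^sub>1\<close>,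
      and \<open>V \<inter> M\<^sub>1\<close> vanishes on \<open>\<alpha> \<times> \<beta>\<close>\<close>
    have block_V_le: "block m n \<alpha> \<beta> S \<in> ?M\<^sub>2" if S: "S \<in> V" for S
    proof -
      have "block m n \<alpha>' \<beta>' (block m n \<alpha> \<beta> S) = op_zero m n"
        if \<alpha>': "\<alpha>' \<in> sets m" and \<beta>': "\<beta>' \<in> sets n" and null: "marginally_null m n ((\<alpha>' \<times> \<beta>') \<inter> \<kappa>\<^sub>2)" for \<alpha>' \<beta>'
      proof -
        have "S \<in> M_max m n (\<kappa>\<^sub>2 \<union> \<kappa>\<^sub>1)"
          using S VM by (auto simp: Un_commute)
        then have "block m n \<alpha>' \<beta>' S \<in> V \<inter> ?M\<^sub>1"
          using block_in_M_max_of_Un[OF _ \<alpha>' \<beta>' null] bimodule_block[OF Vb S \<alpha>' \<beta>'] by blast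
        then have "block m n \<alpha> \<beta> (block m n \<alpha>' \<beta>' S) = op_zero m n"
          using van\<^sub>1 by (simp add: vanishes_on_def)
        then show ?thesis
          using \<alpha> \<beta> \<alpha>' \<beta>' V_bd[OF S] by (simp add: block_block Int_commute)
      qed
      then show ?thesis
        using block_bounded[OF \<alpha> \<beta> V_bd[OF S]] by (simp add: M_max_iff)
    qed
    \<comment> \<open>\<open>W\<close> restricts \<open>M\<^sub>2\<close> only inside \<open>\<alpha> \<times> \<beta>\<close>, where it still contains the blocks of \<open>V\<close>; so it has
      the map of \<open>M\<^sub>2\<close>\<close>
    define W where "W = {S \<in> ?M\<^sub>2. block m n \<alpha> \<beta> S \<in> V}"
    have W: "closed_bimodule m n W"
      unfolding closed_bimodule_def
    proof
      show "bimodule m n W"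
      proof (rule bimoduleI)
        note M2 = bimodule_M_max[of m n \<kappa>\<^sub>2]
        note M2_bd = bimodule_bounded[OF M2]
        show "T \<in> bounded_ops m n" if "T \<in> W" for T
          using that M2_bd by (simp add: W_def)
        show "op_zero m n \<in> W"
          using bimodule_zero[OF M2] bimodule_zero[OF Vb] \<alpha> \<beta> by (simp add: W_def block_zero)
        show "op_add m n S T \<in> W" if "S \<in> W" "T \<in> W" for S T
          using that bimodule_add[OF M2] bimodule_add[OF Vb] \<alpha> \<beta> M2_bd by (simp add: W_def block_add)
        show "sandwich m n \<phi> \<psi> T \<in> W" if "T \<in> W" "ess_bounded m \<phi>" "ess_bounded n \<psi>" for T \<phi> \<psi>
          using that bimodule_sandwich[OF M2] bimodule_sandwich[OF Vb] \<alpha> \<beta> M2_bd by (simp add: W_def block_sandwich_commute)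
      qed
      show "closedin (ultraweak_topology m n) W"
        unfolding W_def block_def
        by (rule closedin_continuous_map_preimage_gen[OF continuous_map_sandwich M_closed Vc])
          (simp_all add: ess_bounded_indicator \<alpha> \<beta>)
    qed
    have "vanishes_on m n ?M\<^sub>2 \<alpha>' \<beta>'" if \<alpha>': "\<alpha>' \<in> sets m" and \<beta>': "\<beta>' \<in> sets n"
      and vanW: "vanishes_on m n W \<alpha>' \<beta>'" for \<alpha>' \<beta>'
      unfolding vanishes_on_def
    proof
      fix T assume T: "T \<in> ?M\<^sub>2"
      then have Tb: "T \<in> bounded_ops m n"
        by (simp add: M_max_iff)
      let ?R = "block m n \<alpha> \<beta> T"
      have Rb: "?R \<in> bounded_ops m n"
        by (rule block_bounded[OF \<alpha> \<beta> Tb])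
      have "block m n (\<alpha>' \<inter> \<alpha>) (\<beta>' \<inter> \<beta>) S = op_zero m n" if S: "S \<in> V" for S
      proof -
        have "block m n \<alpha> \<beta> (block m n \<alpha> \<beta> S) \<in> V"
          by (intro bimodule_block[OF Vb] S \<alpha> \<beta>)
        then have "block m n \<alpha> \<beta> S \<in> W"
          using block_V_le[OF S] by (simp add: W_def)
        then show ?thesis
          using vanW \<alpha> \<beta> \<alpha>' \<beta>' V_bd[OF S] by (auto simp: vanishes_on_def block_block)
      qed
      then have "vanishes_on m n ?M (\<alpha>' \<inter> \<alpha>) (\<beta>' \<inter> \<beta>)"
        using van[of "\<alpha>' \<inter> \<alpha>" "\<beta>' \<inter> \<beta>"] \<alpha> \<beta> \<alpha>' \<beta>' by (auto simp: vanishes_on_def)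
      then have R0: "block m n \<alpha>' \<beta>' ?R = op_zero m n"
        using T M2_M \<alpha> \<beta> \<alpha>' \<beta>' by (auto simp: vanishes_on_def block_block Tb)
      \<comment> \<open>\<open>T\<close> is split into its block over \<open>\<alpha> \<times> \<beta>\<close>, controlled through \<open>V\<close>, and a remainder whose block
        over \<open>\<alpha> \<times> \<beta>\<close> is zero, which is in \<open>W\<close> for that reason\<close>
      let ?D = "op_add m n T (op_scale m n (-1) ?R)"
      have "block m n \<alpha> \<beta> ?D = op_add m n ?R (op_scale m n (-1) ?R)"
        using \<alpha> \<beta> by (simp add: block_add block_scale Tb Rb op_scale_bounded block_block)
      also have "\<dots> = op_zero m n"
        by (rule bounded_ops_eqI[OF op_add_bounded[OF Rb op_scale_bounded[OF Rb]] op_zero_bounded])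
          (simp add: op_add_apply op_scale_apply op_zero_apply l2_add_neg bounded_ops_in_L2[OF Rb])
      finally have "?D \<in> W"
        using T \<alpha> \<beta> bimodule_zero[OF Vb]
        by (simp add: W_def bimodule_add[OF bimodule_M_max] bimodule_scale[OF bimodule_M_max]
            bimodule_block[OF bimodule_M_max])
      then have "block m n \<alpha>' \<beta>' ?D = op_zero m n"
        using vanW by (simp add: vanishes_on_def)
      moreover have "block m n \<alpha>' \<beta>' ?D = block m n \<alpha>' \<beta>' T"
        using \<alpha>' \<beta>' by (simp add: block_add block_scale Tb Rb op_scale_bounded R0 op_scale_zero
            op_add_zero block_bounded)
      ultimately show "block m n \<alpha>' \<beta>' T = op_zero m n"
        by simp
    qed
    then have "W = ?M\<^sub>2"
      using syn\<^sub>2 W vanishes_on_mono[of m n ?M\<^sub>2 _ _ W]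
      unfolding synthetic_iff_vanishes_on[OF fin] W_def by blast
    show ?thesis
      unfolding vanishes_on_def
    proof
      fix T assume T: "T \<in> ?M\<^sub>1"
      then have Tb: "T \<in> bounded_ops m n"
        by (simp add: M_max_iff)
      let ?R = "block m n \<alpha> \<beta> T"
      have R1: "?R \<in> ?M\<^sub>1"
        by (rule bimodule_block[OF bimodule_M_max T \<alpha> \<beta>])
      have idem: "block m n \<alpha> \<beta> ?R = ?R"
        using \<alpha> \<beta> Tb by (simp add: block_block)
      have "block m n \<alpha>' \<beta>' ?R = op_zero m n"
        if \<alpha>': "\<alpha>' \<in> sets m" and \<beta>': "\<beta>' \<in> sets n" and null: "marginally_null m n ((\<alpha>' \<times> \<beta>') \<inter> \<kappa>\<^sub>2)" for \<alpha>' \<beta>'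
      proof -
        have "block m n (\<alpha>' \<inter> \<alpha>) (\<beta>' \<inter> \<beta>) S = op_zero m n" if S: "S \<in> V" for S
          using block_V_le[OF S] \<alpha> \<beta> \<alpha>' \<beta>' null V_bd[OF S] by (simp add: M_max_iff block_block[symmetric])
        then have "vanishes_on m n ?M (\<alpha>' \<inter> \<alpha>) (\<beta>' \<inter> \<beta>)"
          using van[of "\<alpha>' \<inter> \<alpha>" "\<beta>' \<inter> \<beta>"] \<alpha> \<beta> \<alpha>' \<beta>' by (auto simp: vanishes_on_def)
        then show ?thesis
          using T M1_M \<alpha> \<beta> \<alpha>' \<beta>' by (auto simp: vanishes_on_def block_block Tb)
      qed
      then have "?R \<in> ?M\<^sub>2"
        using block_bounded[OF \<alpha> \<beta> Tb] by (simp add: M_max_iff)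
      then have "?R \<in> W"
        using \<open>W = ?M\<^sub>2\<close> by simp
      then have "?R \<in> V"
        using idem by (simp add: W_def)
      then show "?R = op_zero m n"
        using van\<^sub>1 R1 idem by (auto simp: vanishes_on_def)
    qed
  qed
  moreover have "closed_bimodule m n (V \<inter> ?M\<^sub>1)"
    using bimoduleD[OF Vb] bimoduleD[OF bimodule_M_max[of m n \<kappa>\<^sub>1]] Vc M_closed
    unfolding closed_bimodule_def by (intro conjI bimoduleI closedin_Int) auto
  ultimately have "V \<inter> ?M\<^sub>1 = ?M\<^sub>1"
    using syn\<^sub>1 vanishes_on_mono[of m n ?M\<^sub>1 _ _ "V \<inter> ?M\<^sub>1"]
    unfolding synthetic_iff_vanishes_on[OF fin] by blast
  then show ?thesis
    by blast
qed

lemma M_max_sum_dense_imp_synthetic: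
  assumes fin: "finite_measure m" "finite_measure n"
    and syn\<^sub>1: "synthetic m n \<kappa>\<^sub>1" and syn\<^sub>2: "synthetic m n \<kappa>\<^sub>2"
    and dense: "M_max m n (\<kappa>\<^sub>1 \<union> \<kappa>\<^sub>2) \<subseteq>
      ultraweak_topology m n closure_of op_set_plus m n (M_max m n \<kappa>\<^sub>1) (M_max m n \<kappa>\<^sub>2)"
  shows "synthetic m n (\<kappa>\<^sub>1 \<union> \<kappa>\<^sub>2)"
  unfolding synthetic_iff_vanishes_on[OF fin]
proof (intro allI impI)
  fix V
  assume V: "closed_bimodule m n V"
    and van: "\<forall>\<alpha>\<in>sets m. \<forall>\<beta>\<in>sets n.
      vanishes_on m n V \<alpha> \<beta> \<longleftrightarrow> vanishes_on m n (M_max m n (\<kappa>\<^sub>1 \<union> \<kappa>\<^sub>2)) \<alpha> \<beta>"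
  have Vb: "bimodule m n V" and Vc: "closedin (ultraweak_topology m n) V"
    using V by (auto simp: closed_bimodule_def)
  have "M_max m n \<kappa>\<^sub>1 \<subseteq> V"
    by (rule synthetic_piece_subset[OF fin syn\<^sub>1 syn\<^sub>2 V]) (simp add: van)
  moreover have "M_max m n \<kappa>\<^sub>2 \<subseteq> V"
    by (rule synthetic_piece_subset[OF fin syn\<^sub>2 syn\<^sub>1 V]) (simp add: van Un_commute[of \<kappa>\<^sub>2])
  ultimately have "op_set_plus m n (M_max m n \<kappa>\<^sub>1) (M_max m n \<kappa>\<^sub>2) \<subseteq> V"
    using bimodule_add[OF Vb] by (auto simp: op_set_plus_def)
  then have "ultraweak_topology m n closure_of op_set_plus m n (M_max m n \<kappa>\<^sub>1) (M_max m n \<kappa>\<^sub>2) \<subseteq> V"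
    using Vc by (rule closure_of_minimal)
  then have "M_max m n (\<kappa>\<^sub>1 \<union> \<kappa>\<^sub>2) \<subseteq> V"
    using dense by blast
  moreover have "V \<subseteq> M_max m n (\<kappa>\<^sub>1 \<union> \<kappa>\<^sub>2)"
    by (rule M_maxI_vanishes_on) (simp_all add: van bimodule_bounded[OF Vb])
  ultimately show "V = M_max m n (\<kappa>\<^sub>1 \<union> \<kappa>\<^sub>2)"
    by blast
qed

theorem proposition3p8:
  fixes m :: "'a::compact_metric_space measure"
    and n :: "'b::compact_metric_space measure"
    and \<kappa>\<^sub>1 \<kappa>\<^sub>2 :: "('a \<times> 'b) set"
  assumes "regular_borel_measure m" and "regular_borel_measure n"
    and "closed \<kappa>\<^sub>1" and "closed \<kappa>\<^sub>2"
    and "synthetic m n \<kappa>\<^sub>1" and "synthetic m n \<kappa>\<^sub>2"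
  shows "synthetic m n (\<kappa>\<^sub>1 \<union> \<kappa>\<^sub>2) \<longleftrightarrow>
    M_max m n (\<kappa>\<^sub>1 \<union> \<kappa>\<^sub>2) \<subseteq>
      ultraweak_topology m n closure_of op_set_plus m n (M_max m n \<kappa>\<^sub>1) (M_max m n \<kappa>\<^sub>2)"
proof -
  note fin = regular_borel_measure_finite[OF assms(1)] regular_borel_measure_finite[OF assms(2)]
  show ?thesis
    using synthetic_imp_M_max_sum_dense[OF fin, of \<kappa>\<^sub>1 \<kappa>\<^sub>2]
      M_max_sum_dense_imp_synthetic[OF fin assms(5,6)] by blast
qed

end
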